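(* Let $\rho,\sigma,\tau,\{\rho_j\},\{\sigma_j\}$ be density operators on finite-dimensional Hilbert spaces and $\{p_j\}$ a probability distribution. Then: (i) For $\alpha\in(0,1)\cup(1,\infty),\beta\in(-\infty,0)\cup(0,\infty)$: $J'_{\alpha,\beta}(\rho,\sigma)\ge0$, with equality if and only if $\rho=\sigma$. (ii) For $\alpha\in(0,1)\cup(1,\infty),\beta\in(-\infty,0)\cup(0,\infty)$: $J'_{\alpha,\beta}(\rho\otimes\tau,\sigma\otimes\tau)=J'_{\alpha,\beta}(\rho,\sigma)$. (iii) For $\alpha\in(0,1),\beta\in(-\infty,0)\cup(0,1]$ and any quantum operation (CPTP map) $\mathcal E$: $J'_{\alpha,\beta}(\mathcal E(\rho),\mathcal E(\sigma))\le J'_{\alpha,\beta}(\rho,\sigma)$. (iv) For $\alpha\in(0,1)\cup(1,\infty),\beta\in(-\infty,0)\cup(0,\infty)$ and any unitary $U$: $J'_{\alpha,\beta}(U\rho U^\dagger,U\sigma U^\dagger)=J'_{\alpha,\beta}(\rho,\sigma)$. (v) For $\alpha\in(0,1),\beta\in(-\infty,0)\cup(0,1]$: $J'_{\alpha,\beta}\big(\sum_jp_j\rho_j,\sum_jp_j\sigma_j\big)\le\sum_jp_jJ'_{\alpha,\beta}(\rho_j,\sigma_j)$. (vi) For $\alpha\in(0,1)\cup(1,\infty),\beta\in(-\infty,0)\cup(0,\infty)$: $J'_{\alpha,\beta}(\rho,\sigma)=J'_{\alpha,\beta}(\sigma,\rho)$.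
   Context: For density operators $\rho,\sigma$, $\alpha\in(0,1)\cup(1,\infty)$, $\beta\in(-\infty,0)\cup(0,\infty)$, the quantum $(\alpha,\beta)$-relative entropy is $D_{\alpha,\beta}(\rho\|\sigma)=\frac{1}{(1-\alpha)\beta}\big[1-(\mathrm{Tr}(\rho^{\alpha}\sigma^{1-\alpha}))^{\beta}\big]$, where any negative power of a density operator is taken only on its support (zero eigenvalues are kept as zero). The quantum $(\alpha,\beta)$ Jensen–Shannon divergence (second version) is $J'_{\alpha,\beta}(\rho,\sigma)=\tfrac12\big[D_{\alpha,\beta}\big(\rho\|\tfrac{\rho+\sigma}{2}\big)+D_{\alpha,\beta}\big(\sigma\|\tfrac{\rho+\sigma}{2}\big)\big]$. *)

theory Defs
  imports "Jordan_Normal_Form.Schur_Decomposition"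
begin

definition mtrace :: "complex mat \<Rightarrow> complex" where
  "mtrace A = (\<Sum>i<dim_row A. A $$ (i,i))"

definition psd :: "nat \<Rightarrow> complex mat \<Rightarrow> bool" where
  "psd n A \<longleftrightarrow> A \<in> carrier_mat n n \<and>
     (\<forall>v \<in> carrier_vec n.
        let q = (\<Sum>i<n. \<Sum>j<n. cnj (v $ i) * A $$ (i,j) * v $ j) in Im q = 0 \<and> Re q \<ge> 0)"

definition density :: "nat \<Rightarrow> complex mat \<Rightarrow> bool" where
  "density n \<rho> \<longleftrightarrow> psd n \<rho> \<and> mtrace \<rho> = 1"

definition unitary_mat :: "nat \<Rightarrow> complex mat \<Rightarrow> bool" where
  "unitary_mat n U \<longleftrightarrow> U \<in> carrier_mat n n \<and> U * mat_adjoint U = 1\<^sub>m n \<and> mat_adjoint U * U = 1\<^sub>m n"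

definition real_diag :: "nat \<Rightarrow> (nat \<Rightarrow> real) \<Rightarrow> complex mat" where
  "real_diag n l = mat_diag n (\<lambda>i. complex_of_real (l i))"

definition spec_decomp :: "complex mat \<Rightarrow> complex mat \<Rightarrow> (nat \<Rightarrow> real) \<Rightarrow> bool" where
  "spec_decomp A U l \<longleftrightarrow> unitary_mat (dim_row A) U \<and> A = U * real_diag (dim_row A) l * mat_adjoint U"

text \<open>Real power of a positive semidefinite matrix via its spectral decomposition.
  Since 0 powr a = 0 in Isabelle, zero eigenvalues are kept as zero, i.e. negative
  powers are taken on the support only.\<close>
definition mat_powr :: "complex mat \<Rightarrow> real \<Rightarrow> complex mat" where
  "mat_powr A a = (let (U, l) = (SOME (U, l). spec_decomp A U l)
                   in U * real_diag (dim_row A) (\<lambda>i. l i powr a) * mat_adjoint U)"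

definition D_ab :: "real \<Rightarrow> real \<Rightarrow> complex mat \<Rightarrow> complex mat \<Rightarrow> real" where
  "D_ab \<alpha> \<beta> \<rho> \<sigma> =
     (1 - (Re (mtrace (mat_powr \<rho> \<alpha> * mat_powr \<sigma> (1 - \<alpha>)))) powr \<beta>) / ((1 - \<alpha>) * \<beta>)"

definition J'_ab :: "real \<Rightarrow> real \<Rightarrow> complex mat \<Rightarrow> complex mat \<Rightarrow> real" where
  "J'_ab \<alpha> \<beta> \<rho> \<sigma> =
     (D_ab \<alpha> \<beta> \<rho> ((1/2) \<cdot>\<^sub>m (\<rho> + \<sigma>)) + D_ab \<alpha> \<beta> \<sigma> ((1/2) \<cdot>\<^sub>m (\<rho> + \<sigma>))) / 2"

text \<open>Kronecker (tensor) product; index (a*dim B + r) corresponds to basis vector e_a (x) e_r.\<close>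
definition kron :: "complex mat \<Rightarrow> complex mat \<Rightarrow> complex mat" where
  "kron A B = mat (dim_row A * dim_row B) (dim_col A * dim_col B)
     (\<lambda>(i,j). A $$ (i div dim_row B, j div dim_col B) * B $$ (i mod dim_row B, j mod dim_col B))"

text \<open>The map id_k (x) E applied to a (k*n) x (k*n) matrix, blockwise.\<close>
definition ampl :: "nat \<Rightarrow> nat \<Rightarrow> nat \<Rightarrow> (complex mat \<Rightarrow> complex mat) \<Rightarrow> complex mat \<Rightarrow> complex mat" where
  "ampl k n m E X = mat (k*m) (k*m)
     (\<lambda>(i,j). E (mat n n (\<lambda>(r,s). X $$ ((i div m)*n + r, (j div m)*n + s))) $$ (i mod m, j mod m))"

definition cptp :: "nat \<Rightarrow> nat \<Rightarrow> (complex mat \<Rightarrow> complex mat) \<Rightarrow> bool" where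
  "cptp n m E \<longleftrightarrow>
     (\<forall>X \<in> carrier_mat n n. E X \<in> carrier_mat m m) \<and>
     (\<forall>X \<in> carrier_mat n n. \<forall>Y \<in> carrier_mat n n. E (X + Y) = E X + E Y) \<and>
     (\<forall>X \<in> carrier_mat n n. \<forall>c. E (c \<cdot>\<^sub>m X) = c \<cdot>\<^sub>m E X) \<and>
     (\<forall>X \<in> carrier_mat n n. mtrace (E X) = mtrace X) \<and>
     (\<forall>k. \<forall>X. psd (k*n) X \<longrightarrow> psd (k*m) (ampl k n m E X))"

definition mix :: "nat \<Rightarrow> 'j set \<Rightarrow> ('j \<Rightarrow> real) \<Rightarrow> ('j \<Rightarrow> complex mat) \<Rightarrow> complex mat" where
  "mix n J p \<rho> = mat n n (\<lambda>(a,b). \<Sum>j\<in>J. complex_of_real (p j) * \<rho> j $$ (a,b))"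

end

theory Submission
  imports "HOL-Analysis.Equivalence_Lebesgue_Henstock_Integration"
    "Jordan_Normal_Form.Spectral_Radius" Defs
begin

text \<open>
  In eigenbases of \<open>\<rho> = U diag(r) U\<^sup>\<dagger>\<close> and \<open>\<sigma> = V diag(t) V\<^sup>\<dagger>\<close> the trace of
  \<open>\<rho>\<^sup>\<alpha> \<sigma>\<^sup>1\<^sup>-\<^sup>\<alpha>\<close> is the sum of \<open>w i j * (r i powr \<alpha> * t j powr (1 - \<alpha>))\<close>, where
  \<open>w i j = |(U\<^sup>\<dagger>V) i j|\<^sup>2\<close> is doubly stochastic.  Young's inequality and its reverse then give
  positivity and the equality case; the support of \<open>\<rho>\<close> lies in that of the midpoint, so no term is
  lost to the convention \<open>0 powr a = 0\<close>.

  For \<open>0 < \<alpha> < 1\<close>, \<open>r powr \<alpha> * t powr (1 - \<alpha>)\<close> is an integral over \<open>s > 0\<close> of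
  \<open>r t / (r + s t)\<close> against a positive kernel, and \<open>s\<close> times the corresponding matrix quantity is
  the minimum over \<open>X\<close> of \<open>Tr(\<rho> X X\<^sup>\<dagger>) + s Tr(\<sigma> (1 - X)\<^sup>\<dagger> (1 - X))\<close>.  A minimum of linear
  functions of \<open>(\<rho>, \<sigma>)\<close> is jointly concave; and for a quantum operation the dual image \<open>X\<close> of a
  minimiser \<open>Y\<close> for the output states is no worse for the input states, by the Kadison--Schwarz
  inequality.  Joint convexity and monotonicity follow because \<open>x \<mapsto> (1 - x powr \<beta>) / \<beta>\<close> is
  decreasing, and convex when \<open>\<beta> \<le> 1\<close>.
\<close>

unbundle no vec_syntax
unbundle no inner_syntax


subsection \<open>Adjoints, traces and unitary matrices\<close>

text \<open>The obstacle is that two states have different eigenbases. A single trace sees this only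
  through the overlaps, which is enough for positivity; joint concavity and monotonicity compare
  several pairs of states, whose overlaps are unrelated. A trial matrix \<open>X\<close>, unlike an
  eigenbasis, can be shared by several pairs or carried through a channel. The two factors in the
  minimised form stand in opposite order on purpose. For \<open>X = U Z V\<^sup>\<dagger>\<close>
  the first term weights the rows of \<open>Z\<close> by \<open>r\<close>, the second the columns of
  \<open>U\<^sup>\<dagger>V - Z\<close> by \<open>t\<close>, so the minimisation splits into one
  scalar problem per entry although the matrices do not commute. The constant of the integral
  formula is pi / sin(pi \<alpha>); the comparison uses its positivity alone. Strict positivity of
  the traces against the midpoint matters as well: for negative \<beta> the convention
  \<open>0 powr \<beta> = 0\<close> would destroy monotonicity in the trace.\<close>

lemma mat_adjoint_carrier [simp, intro]: "A \<in> carrier_mat n m \<Longrightarrow> mat_adjoint A \<in> carrier_mat m n"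
  by (auto simp: mat_adjoint_def)

lemma mat_adjoint_dim [simp]: "dim_row (mat_adjoint A) = dim_col A" "dim_col (mat_adjoint A) = dim_row A"
  by (auto simp: mat_adjoint_def)

lemma mat_adjoint_index [simp]:
  fixes A :: "complex mat"
  assumes "i < dim_col A" "j < dim_row A"
  shows "mat_adjoint A $$ (i, j) = cnj (A $$ (j, i))"
  using assms by (simp add: mat_adjoint_def mat_of_rows_index)

lemma mat_adjoint_adjoint [simp]: "mat_adjoint (mat_adjoint A) = (A :: complex mat)"
  by (rule eq_matI) auto

lemma mult_mat_index_sum:
  assumes "A \<in> carrier_mat n m" "B \<in> carrier_mat m k" "i < n" "j < k"
  shows "(A * B) $$ (i, j) = (\<Sum>l<m. A $$ (i, l) * B $$ (l, j))"
  using assms by (simp add: scalar_prod_def atLeast0LessThan)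

lemma mat_adjoint_mult:
  fixes A B :: "complex mat"
  assumes A: "A \<in> carrier_mat n m" and B: "B \<in> carrier_mat m k"
  shows "mat_adjoint (A * B) = mat_adjoint B * mat_adjoint A"
proof (rule eq_matI)
  have BA: "mat_adjoint B * mat_adjoint A \<in> carrier_mat k n"
    using A B by (intro mult_carrier_mat) auto
  fix i j assume "i < dim_row (mat_adjoint B * mat_adjoint A)" "j < dim_col (mat_adjoint B * mat_adjoint A)"
  then have ij: "i < k" "j < n" using BA by auto
  have "mat_adjoint (A * B) $$ (i, j) = cnj ((A * B) $$ (j, i))"
    using A B ij by (intro mat_adjoint_index) auto
  also have "\<dots> = (\<Sum>l<m. mat_adjoint B $$ (i, l) * mat_adjoint A $$ (l, j))"
    using A B ij by (subst mult_mat_index_sum[OF A B]) (auto simp: mult.commute)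
  also have "\<dots> = (mat_adjoint B * mat_adjoint A) $$ (i, j)"
    using A B ij by (subst mult_mat_index_sum[of _ k m _ n]) auto
  finally show "mat_adjoint (A * B) $$ (i, j) = (mat_adjoint B * mat_adjoint A) $$ (i, j)" .
qed (use A B in auto)

lemma real_diag_carrier [simp, intro]: "real_diag n l \<in> carrier_mat n n"
  by (simp add: real_diag_def mat_diag_def)

lemma real_diag_dim [simp]: "dim_row (real_diag n l) = n" "dim_col (real_diag n l) = n"
  by (simp_all add: real_diag_def mat_diag_def)

lemma real_diag_index:
  "i < n \<Longrightarrow> j < n \<Longrightarrow> real_diag n l $$ (i, j) = (if i = j then complex_of_real (l j) else 0)"
  by (simp add: real_diag_def mat_diag_def)

lemma real_diag_mult_left_index:
  assumes "A \<in> carrier_mat n m" "i < n" "j < m"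
  shows "(real_diag n l * A) $$ (i, j) = l i * A $$ (i, j)"
  unfolding real_diag_def using assms by (simp add: mat_diag_mult_left[OF assms(1)])

lemma real_diag_mult_right_index:
  assumes "A \<in> carrier_mat m n" "i < m" "j < n"
  shows "(A * real_diag n l) $$ (i, j) = A $$ (i, j) * l j"
  unfolding real_diag_def using assms by (simp add: mat_diag_mult_right[OF assms(1)])

lemma mtrace_mult_eq:
  assumes A: "A \<in> carrier_mat n m" and B: "B \<in> carrier_mat m n"
  shows "mtrace (A * B) = (\<Sum>i<n. \<Sum>k<m. A $$ (i, k) * B $$ (k, i))"
  unfolding mtrace_def using A B
  by (intro sum.cong) (auto simp: mult_mat_index_sum[OF A B] simp del: index_mult_mat(1))

lemma mtrace_comm:
  assumes A: "A \<in> carrier_mat n m" and B: "B \<in> carrier_mat m n"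
  shows "mtrace (A * B) = mtrace (B * A)"
  unfolding mtrace_mult_eq[OF A B] mtrace_mult_eq[OF B A] by (subst sum.swap) (simp add: mult.commute)

lemma mtrace_add: "A \<in> carrier_mat n n \<Longrightarrow> B \<in> carrier_mat n n \<Longrightarrow> mtrace (A + B) = mtrace A + mtrace B"
  by (auto simp: mtrace_def sum.distrib)

lemma mtrace_smult: "A \<in> carrier_mat n n \<Longrightarrow> mtrace (c \<cdot>\<^sub>m A) = c * mtrace A"
  by (auto simp: mtrace_def sum_distrib_left)

lemma unitary_carrier [dest]: "unitary_mat n U \<Longrightarrow> U \<in> carrier_mat n n"
  by (simp add: unitary_mat_def)

lemma unitary_adjoint [intro]: "unitary_mat n U \<Longrightarrow> unitary_mat n (mat_adjoint U)"
  by (auto simp: unitary_mat_def)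

lemma unitary_cancel:
  assumes "unitary_mat n U" "A \<in> carrier_mat n m"
  shows "U * (mat_adjoint U * A) = A" "mat_adjoint U * (U * A) = A"
proof -
  have U: "U \<in> carrier_mat n n" "mat_adjoint U \<in> carrier_mat n n" using assms by auto
  show "U * (mat_adjoint U * A) = A" "mat_adjoint U * (U * A) = A"
    using assms assoc_mult_mat[OF U assms(2)] assoc_mult_mat[OF U(2) U(1) assms(2)]
    by (auto simp: unitary_mat_def)
qed

lemma unitary_mult [intro]:
  assumes "unitary_mat n U" "unitary_mat n V"
  shows "unitary_mat n (U * V)"
proof -
  have c: "U \<in> carrier_mat n n" "V \<in> carrier_mat n n"
     "mat_adjoint U \<in> carrier_mat n n" "mat_adjoint V \<in> carrier_mat n n" using assms by auto
  have "U * V * (mat_adjoint V * mat_adjoint U) = U * (V * (mat_adjoint V * mat_adjoint U))"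
    using c by (intro assoc_mult_mat) auto
  moreover have "mat_adjoint V * mat_adjoint U * (U * V) = mat_adjoint V * (mat_adjoint U * (U * V))"
    using c by (intro assoc_mult_mat) auto
  ultimately show ?thesis
    using assms c unfolding unitary_mat_def
    by (auto simp: mat_adjoint_mult[of U n n V n] unitary_cancel[OF assms(1)] unitary_cancel[OF assms(2)])
qed

lemma unitary_row_sum:
  assumes W: "unitary_mat n W" and i: "i < n"
  shows "(\<Sum>j<n. (cmod (W $$ (i, j)))\<^sup>2) = 1"
proof -
  have Wc: "W \<in> carrier_mat n n" using W by auto
  have "1 = (W * mat_adjoint W) $$ (i, i)" using W i by (simp add: unitary_mat_def)
  also have "\<dots> = (\<Sum>j<n. W $$ (i, j) * cnj (W $$ (i, j)))"
    using Wc i by (subst mult_mat_index_sum[of _ n n _ n]) auto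
  also have "\<dots> = complex_of_real (\<Sum>j<n. (cmod (W $$ (i, j)))\<^sup>2)"
    by (simp only: of_real_sum complex_norm_square)
  finally show ?thesis by (metis of_real_eq_1_iff)
qed

lemma unitary_col_sum:
  assumes W: "unitary_mat n W" and j: "j < n"
  shows "(\<Sum>i<n. (cmod (W $$ (i, j)))\<^sup>2) = 1"
proof -
  have Wc: "W \<in> carrier_mat n n" using W by auto
  then have "(\<Sum>i<n. (cmod (mat_adjoint W $$ (j, i)))\<^sup>2) = 1"
    using W j by (intro unitary_row_sum) auto
  then show ?thesis using Wc j by auto
qed

text \<open>Multiplying by \<open>mat_adjoint V\<close> on the left and \<open>U\<close> on the
  right turns the equation into \<open>W * real_diag n l = real_diag n k * W\<close> with
  \<open>W = mat_adjoint V * U\<close>, which is then read entrywise. The criterion serves twice: it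
  makes matrix powers well defined, and it settles the equality case of positivity.\<close>

lemma spec_eq_iff:
  assumes U: "unitary_mat n U" and V: "unitary_mat n V"
  shows "U * real_diag n l * mat_adjoint U = V * real_diag n k * mat_adjoint V \<longleftrightarrow>
    (\<forall>i<n. \<forall>j<n. (mat_adjoint V * U) $$ (i, j) \<noteq> 0 \<longrightarrow> k i = l j)" (is "?L \<longleftrightarrow> ?R")
proof -
  have c: "U \<in> carrier_mat n n" "V \<in> carrier_mat n n"
     "mat_adjoint U \<in> carrier_mat n n" "mat_adjoint V \<in> carrier_mat n n" using U V by auto
  define W where "W = mat_adjoint V * U"
  have Wc: "W \<in> carrier_mat n n" using c by (auto simp: W_def)
  have "W * real_diag n l = real_diag n k * W \<longleftrightarrow> ?R"
  proof
    assume eq: "W * real_diag n l = real_diag n k * W"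
    show ?R
    proof (intro allI impI)
      fix i j assume ij: "i < n" "j < n" and "(mat_adjoint V * U) $$ (i, j) \<noteq> 0"
      then show "k i = l j"
        using real_diag_mult_left_index[OF Wc ij, of k] real_diag_mult_right_index[OF Wc ij, of l] eq
        by (simp add: W_def[symmetric])
    qed
  next
    assume R: ?R
    show "W * real_diag n l = real_diag n k * W"
    proof (rule eq_matI)
      fix i j assume "i < dim_row (real_diag n k * W)" "j < dim_col (real_diag n k * W)"
      then have ij: "i < n" "j < n" using Wc by auto
      have "W $$ (i, j) * l j = k i * W $$ (i, j)"
        using R ij by (cases "W $$ (i, j) = 0") (auto simp: W_def)
      then show "(W * real_diag n l) $$ (i, j) = (real_diag n k * W) $$ (i, j)"
        using real_diag_mult_left_index[OF Wc ij] real_diag_mult_right_index[OF Wc ij] by simp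
    qed (use Wc in auto)
  qed
  moreover have "?L \<longleftrightarrow> W * real_diag n l = real_diag n k * W"
  proof
    have left: "mat_adjoint V * (U * real_diag n l * mat_adjoint U) * U = W * real_diag n l"
    proof -
      have "mat_adjoint V * (U * real_diag n l * mat_adjoint U) * U
          = mat_adjoint V * (U * (real_diag n l * (mat_adjoint U * U)))"
        using c by (simp add: assoc_mult_mat[of _ n n _ n _ n] mult_carrier_mat[of _ n n _ n])
      also have "\<dots> = W * real_diag n l"
        using U c by (simp add: unitary_mat_def W_def assoc_mult_mat[of _ n n _ n _ n])
      finally show ?thesis .
    qed
    have right: "mat_adjoint V * (V * real_diag n k * mat_adjoint V) * U = real_diag n k * W"
    proof -
      have "mat_adjoint V * (V * real_diag n k * mat_adjoint V) * U
          = mat_adjoint V * (V * (real_diag n k * (mat_adjoint V * U)))"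
        using c by (simp add: assoc_mult_mat[of _ n n _ n _ n] mult_carrier_mat[of _ n n _ n])
      also have "\<dots> = real_diag n k * W"
        using V c by (simp add: W_def unitary_cancel[of n _ _ n] mult_carrier_mat[of _ n n _ n])
      finally show ?thesis .
    qed
    show "W * real_diag n l = real_diag n k * W" if ?L
      using left right that by simp
  next
    assume WW: "W * real_diag n l = real_diag n k * W"
    have VWU: "V * (W * A) = U * A" if "A \<in> carrier_mat n n" for A
      using V c that by (simp add: W_def assoc_mult_mat[of _ n n _ n _ n] unitary_cancel[of n _ _ n] mult_carrier_mat[of _ n n _ n])
    have WU: "W * mat_adjoint U = mat_adjoint V"
      using U c by (simp add: W_def assoc_mult_mat[of _ n n _ n _ n] unitary_mat_def)
    have "U * real_diag n l * mat_adjoint U = V * (W * (real_diag n l * mat_adjoint U))"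
      using c by (simp add: VWU assoc_mult_mat[of _ n n _ n _ n] mult_carrier_mat[of _ n n _ n])
    also have "W * (real_diag n l * mat_adjoint U) = W * real_diag n l * mat_adjoint U"
      using c Wc by (simp add: assoc_mult_mat[of _ n n _ n _ n])
    also have "V * (W * real_diag n l * mat_adjoint U) = V * (real_diag n k * (W * mat_adjoint U))"
      unfolding WW using c Wc by (simp add: assoc_mult_mat[of _ n n _ n _ n])
    also have "\<dots> = V * real_diag n k * mat_adjoint V"
      unfolding WU using c by (simp add: assoc_mult_mat[of _ n n _ n _ n])
    finally show ?L .
  qed
  ultimately show ?thesis by blast
qed

text \<open>The criterion of \<open>spec_eq_iff\<close> only tests eigenvalues for equality, so it
  survives applying \<open>f\<close> to both sides. As \<open>mat_powr\<close> picks its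
  decomposition by \<open>SOME\<close>, this is what allows computing it from any other one.\<close>

lemma functional_calculus_unique:
  assumes "unitary_mat n U" "unitary_mat n V"
    and "U * real_diag n l * mat_adjoint U = V * real_diag n k * mat_adjoint V"
  shows "U * real_diag n (\<lambda>i. f (l i)) * mat_adjoint U = V * real_diag n (\<lambda>i. f (k i)) * mat_adjoint V"
  using assms(3) unfolding spec_eq_iff[OF assms(1,2)] by metis

lemma mat_powr_eq:
  assumes A: "A \<in> carrier_mat n n" and "spec_decomp A U l"
  shows "mat_powr A a = U * real_diag n (\<lambda>i. l i powr a) * mat_adjoint U"
proof -
  obtain V k where Vk: "(SOME (U, l). spec_decomp A U l) = (V, k)" by fastforce
  have "spec_decomp A V k"
    using someI_ex[of "\<lambda>(U, l). spec_decomp A U l"] assms(2) unfolding Vk by auto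
  then have "V * real_diag n (\<lambda>i. k i powr a) * mat_adjoint V = U * real_diag n (\<lambda>i. l i powr a) * mat_adjoint U"
    using assms by (intro functional_calculus_unique[where f = "\<lambda>x. x powr a"]) (auto simp: spec_decomp_def)
  then show ?thesis using A by (simp add: mat_powr_def Vk)
qed

lemma spec_decomp_iff:
  "A \<in> carrier_mat n n \<Longrightarrow>
    spec_decomp A U l \<longleftrightarrow> unitary_mat n U \<and> A = U * real_diag n l * mat_adjoint U"
  by (auto simp: spec_decomp_def)

lemma mult_adjoint_index:
  fixes U V :: "complex mat"
  assumes "U \<in> carrier_mat n m" "V \<in> carrier_mat k m" "i < n" "j < k"
  shows "(U * mat_adjoint V) $$ (i, j) = (\<Sum>k<m. U $$ (i, k) * cnj (V $$ (j, k)))"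
  using assms by (subst mult_mat_index_sum[of _ n m _ k]) auto

lemma mult_diag_adjoint_index:
  assumes G: "G \<in> carrier_mat n m" and H: "H \<in> carrier_mat k m" and ij: "i < n" "j < k"
  shows "(G * real_diag m l * mat_adjoint H) $$ (i, j) = (\<Sum>a<m. l a * (G $$ (i, a) * cnj (H $$ (j, a))))"
proof -
  have c: "G * real_diag m l \<in> carrier_mat n m" using G by auto
  show ?thesis
    unfolding mult_adjoint_index[OF c H ij]
    using G ij by (intro sum.cong) (auto simp: real_diag_mult_right_index[OF G] simp del: index_mult_mat(1))
qed

lemma unitary_matI:
  assumes "U \<in> carrier_mat n n" "U * mat_adjoint U = 1\<^sub>m n"
  shows "unitary_mat n U"
  using assms mat_mult_left_right_inverse[of U n "mat_adjoint U"] by (auto simp: unitary_mat_def)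

lemma spec_unitary_congruence:
  assumes U: "unitary_mat n U" and W: "W \<in> carrier_mat n n"
    and A: "A = U * real_diag n l * mat_adjoint U"
  shows "W * A * mat_adjoint W = (W * U) * real_diag n l * mat_adjoint (W * U)"
proof -
  have "U \<in> carrier_mat n n" "mat_adjoint U \<in> carrier_mat n n" "mat_adjoint W \<in> carrier_mat n n"
    using U W by auto
  then show ?thesis
    using W by (simp add: A mat_adjoint_mult[of W n n U n] assoc_mult_mat[of _ n n _ n _ n] mult_carrier_mat[of _ n n _ n])
qed

subsection \<open>The spectral theorem for Hermitian matrices\<close>

text \<open>Complete \<open>v\<close> to a basis, orthogonalise it by Gram-Schmidt with
  \<open>v\<close> first, and normalise; \<open>c\<close> is the reciprocal of the norm of
  \<open>v\<close>.\<close>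

lemma unitary_with_first_column:
  fixes v :: "complex vec"
  assumes v: "v \<in> carrier_vec n" and v0: "v \<noteq> 0\<^sub>v n"
  shows "\<exists>W c. unitary_mat n W \<and> (\<forall>i<n. W $$ (i, 0) = c * v $ i)"
proof -
  interpret cof_vec_space n "TYPE(complex)" .
  define b where "b = basis_completion v"
  define ws where "ws = gram_schmidt n b"
  have n: "0 < n" using v v0 by (cases n) auto
  note bc = basis_completion[OF v v0, folded b_def]
  obtain vs where bv: "b = v # vs" using bc(6,7) n by (cases b) auto
  have ws: "set ws \<subseteq> carrier_vec n" "corthogonal ws" "length ws = n"
    using gram_schmidt_result[OF bc(2,4,5) refl, folded ws_def] bc(6) by auto
  have hdws: "hd ws = v" using gram_schmidt_hd[OF v, of vs, folded bv] by (simp add: ws_def)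
  then have ws0: "ws ! 0 = v" using ws(3) n by (cases ws) auto
  have wsc: "ws ! i \<in> carrier_vec n" if "i < n" for i using ws that by auto
  define ip where "ip i j = (\<Sum>k<n. cnj (ws ! i $ k) * ws ! j $ k)" for i j
  have ip_eq: "ip i j = ws ! j \<bullet>c ws ! i" if "i < n" "j < n" for i j
    using wsc[OF that(1)] wsc[OF that(2)] by (simp add: ip_def scalar_prod_def atLeast0LessThan mult.commute)
  have ip0: "ip i j = 0 \<longleftrightarrow> i \<noteq> j" if "i < n" "j < n" for i j
    using corthogonalD[OF ws(2), of j i] that ws(3) by (auto simp: ip_eq)
  define N where "N i = sqrt (\<Sum>k<n. (cmod (ws ! i $ k))\<^sup>2)" for i
  have ipN: "ip i i = complex_of_real ((N i)\<^sup>2)" for i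
  proof -
    have "ip i i = complex_of_real (\<Sum>k<n. (cmod (ws ! i $ k))\<^sup>2)"
      unfolding ip_def of_real_sum complex_norm_square by (simp add: mult.commute)
    then show ?thesis by (simp add: N_def sum_nonneg)
  qed
  have N0: "N i \<noteq> 0" if "i < n" for i using ipN[of i] ip0[OF that that] by auto
  define W where "W = mat n n (\<lambda>(k, i). ws ! i $ k / N i)"
  have Wc: "W \<in> carrier_mat n n" by (simp add: W_def)
  have "mat_adjoint W * W = 1\<^sub>m n"
  proof (rule eq_matI)
    fix i j assume "i < dim_row (1\<^sub>m n :: complex mat)" "j < dim_col (1\<^sub>m n :: complex mat)"
    then have ij: "i < n" "j < n" by auto
    have "(mat_adjoint W * W) $$ (i, j) = (\<Sum>k<n. mat_adjoint W $$ (i, k) * W $$ (k, j))"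
      using Wc ij by (intro mult_mat_index_sum) auto
    also have "\<dots> = (\<Sum>k<n. (cnj (ws ! i $ k) * ws ! j $ k) / (N i * N j))"
      using Wc ij by (intro sum.cong) (auto simp: W_def)
    also have "\<dots> = ip i j / (N i * N j)" by (simp add: ip_def sum_divide_distrib)
    also have "\<dots> = 1\<^sub>m n $$ (i, j)"
      using ij ip0[OF ij] N0[OF ij(1)] by (cases "i = j") (auto simp: ipN power2_eq_square)
    finally show "(mat_adjoint W * W) $$ (i, j) = 1\<^sub>m n $$ (i, j)" .
  qed (use Wc in auto)
  then have "unitary_mat n (mat_adjoint W)"
    using Wc by (intro unitary_matI) auto
  then have "unitary_mat n W" using unitary_adjoint[of n "mat_adjoint W"] by simp
  moreover have "\<forall>i<n. W $$ (i, 0) = (1 / N 0) * v $ i" using n by (simp add: W_def ws0)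
  ultimately show ?thesis by blast
qed

text \<open>\<open>B\<close> is the direct sum of the number \<open>e\<close> and a diagonalised
  block, so the direct sum of 1 and \<open>U\<close> diagonalises it; \<open>V\<close> is that sum
  with indices shifted by one.\<close>

lemma hermitian_spectral_step:
  assumes U: "unitary_mat m U" and B: "B \<in> carrier_mat (Suc m) (Suc m)"
    and B00: "B $$ (0, 0) = complex_of_real e"
    and B0: "\<And>i. i < m \<Longrightarrow> B $$ (0, Suc i) = 0" "\<And>i. i < m \<Longrightarrow> B $$ (Suc i, 0) = 0"
    and BS: "mat m m (\<lambda>(i, j). B $$ (Suc i, Suc j)) = U * real_diag m l * mat_adjoint U"
  shows "\<exists>V k. unitary_mat (Suc m) V \<and> B = V * real_diag (Suc m) k * mat_adjoint V"
proof -
  have Uc: "U \<in> carrier_mat m m" using U by auto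
  define V where "V = mat (Suc m) (Suc m) (\<lambda>(i, j). case i of 0 \<Rightarrow> (if j = 0 then 1 else 0)
     | Suc i' \<Rightarrow> (case j of 0 \<Rightarrow> 0 | Suc j' \<Rightarrow> U $$ (i', j')))"
  define k where "k = case_nat e l"
  have Vc: "V \<in> carrier_mat (Suc m) (Suc m)" by (simp add: V_def)
  have "V * mat_adjoint V = 1\<^sub>m (Suc m)"
  proof (rule eq_matI)
    fix i j assume "i < dim_row (1\<^sub>m (Suc m) :: complex mat)" "j < dim_col (1\<^sub>m (Suc m) :: complex mat)"
    then have ij: "i < Suc m" "j < Suc m" by auto
    have "(\<Sum>k<m. U $$ (i, k) * cnj (U $$ (j, k))) = (if i = j then 1 else 0)" if "i < m" "j < m" for i j
      using mult_adjoint_index[OF Uc Uc that] U that by (simp add: unitary_mat_def)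
    then show "(V * mat_adjoint V) $$ (i, j) = 1\<^sub>m (Suc m) $$ (i, j)"
      unfolding mult_adjoint_index[OF Vc Vc ij]
      using ij by (cases i; cases j) (simp_all add: V_def sum.lessThan_Suc_shift del: sum.lessThan_Suc)
  qed (use Vc in auto)
  then have "unitary_mat (Suc m) V" using Vc by (intro unitary_matI) auto
  moreover have "B = V * real_diag (Suc m) k * mat_adjoint V"
  proof (rule eq_matI)
    fix i j assume "i < dim_row (V * real_diag (Suc m) k * mat_adjoint V)"
      "j < dim_col (V * real_diag (Suc m) k * mat_adjoint V)"
    then have ij: "i < Suc m" "j < Suc m" using Vc by auto
    have "(\<Sum>k<m. l k * (U $$ (i, k) * cnj (U $$ (j, k)))) = B $$ (Suc i, Suc j)" if "i < m" "j < m" for i j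
      using mult_diag_adjoint_index[OF Uc Uc that, of l] that unfolding BS[symmetric] by simp
    then show "B $$ (i, j) = (V * real_diag (Suc m) k * mat_adjoint V) $$ (i, j)"
      unfolding mult_diag_adjoint_index[OF Vc Vc ij]
      using ij B00 B0 by (cases i; cases j) (simp_all add: V_def k_def sum.lessThan_Suc_shift del: sum.lessThan_Suc)
  qed (use B Vc in auto)
  ultimately show ?thesis by blast
qed

text \<open>Deflation: with an eigenvector as first column of \<open>W\<close>, the first column of
  \<open>mat_adjoint W * (A * W)\<close> is a multiple of the first unit vector. Hermiticity then
  clears the first row, makes the eigenvalue real, and is inherited by the remaining block.\<close>

theorem hermitian_spectral:
  fixes A :: "complex mat"
  assumes "A \<in> carrier_mat n n" "mat_adjoint A = A"
  shows "\<exists>U l. spec_decomp A U l"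
  using assms
proof (induction n arbitrary: A)
  case 0
  then show ?case
    by (intro exI[of _ "1\<^sub>m 0"] exI[of _ "\<lambda>_. 0"]) (auto simp: spec_decomp_def unitary_mat_def intro!: eq_matI)
next
  case (Suc m)
  let ?n = "Suc m"
  note A = Suc.prems(1)
  obtain e where "eigenvalue A e"
    using spectrum_non_empty[OF A] by (auto simp: spectrum_def)
  then obtain v where v: "v \<in> carrier_vec ?n" "v \<noteq> 0\<^sub>v ?n" "A *\<^sub>v v = e \<cdot>\<^sub>v v"
    using A by (auto simp: eigenvalue_def eigenvector_def)
  obtain W c where W: "unitary_mat ?n W" and Wv: "\<forall>i<?n. W $$ (i, 0) = c * v $ i"
    using unitary_with_first_column[OF v(1,2)] by blast
  have Wc: "W \<in> carrier_mat ?n ?n" "mat_adjoint W \<in> carrier_mat ?n ?n" using W by auto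
  define B where "B = mat_adjoint W * (A * W)"
  have Bc: "B \<in> carrier_mat ?n ?n" using A Wc by (auto simp: B_def)
  have B_herm: "mat_adjoint B = B"
    using A Wc Suc.prems(2)
    by (simp add: B_def mat_adjoint_mult[of _ ?n ?n _ ?n] assoc_mult_mat[of _ ?n ?n _ ?n _ ?n] mult_carrier_mat[of _ ?n ?n _ ?n])
  have Bsym: "B $$ (i, j) = cnj (B $$ (j, i))" if "i < ?n" "j < ?n" for i j
    using B_herm mat_adjoint_index[of i B j] that Bc by auto
  have AW: "(A * W) $$ (k, 0) = e * W $$ (k, 0)" if k: "k < ?n" for k
  proof -
    have "(A * W) $$ (k, 0) = (\<Sum>j<?n. A $$ (k, j) * W $$ (j, 0))"
      using A Wc k by (intro mult_mat_index_sum) auto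
    also have "\<dots> = c * (\<Sum>j<?n. A $$ (k, j) * v $ j)"
      using Wv by (simp add: sum_distrib_left mult_ac del: sum.lessThan_Suc)
    also have "(\<Sum>j<?n. A $$ (k, j) * v $ j) = (A *\<^sub>v v) $ k"
      using A v(1) k by (simp add: scalar_prod_def atLeast0LessThan del: sum.lessThan_Suc)
    also have "c * \<dots> = e * W $$ (k, 0)" using v k Wv by simp
    finally show ?thesis .
  qed
  have Bcol: "B $$ (i, 0) = (if i = 0 then e else 0)" if i: "i < ?n" for i
  proof -
    have "B $$ (i, 0) = (\<Sum>k<?n. mat_adjoint W $$ (i, k) * (A * W) $$ (k, 0))"
      unfolding B_def using A Wc i by (intro mult_mat_index_sum) auto
    also have "\<dots> = e * (\<Sum>k<?n. mat_adjoint W $$ (i, k) * W $$ (k, 0))"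
      using AW by (simp add: sum_distrib_left mult_ac del: sum.lessThan_Suc index_mult_mat(1))
    also have "(\<Sum>k<?n. mat_adjoint W $$ (i, k) * W $$ (k, 0)) = (mat_adjoint W * W) $$ (i, 0)"
      using Wc i by (intro mult_mat_index_sum[symmetric]) auto
    also have "e * \<dots> = (if i = 0 then e else 0)" using W i by (simp add: unitary_mat_def)
    finally show ?thesis .
  qed
  have e_real: "e = complex_of_real (Re e)"
    using Bsym[of 0 0] Bcol[of 0] by (simp add: complex_eq_iff)
  define C where "C = mat m m (\<lambda>(i, j). B $$ (Suc i, Suc j))"
  have Cc: "C \<in> carrier_mat m m" by (simp add: C_def)
  have "mat_adjoint C = C"
    by (rule eq_matI) (auto simp: C_def intro!: Bsym[symmetric])
  then obtain U l where "spec_decomp C U l" using Suc.IH[OF Cc] by blast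
  then have U: "unitary_mat m U" "C = U * real_diag m l * mat_adjoint U"
    using Cc by (auto simp: spec_decomp_def)
  have B00: "B $$ (0, 0) = complex_of_real (Re e)" using Bcol[of 0] e_real by simp
  have Bcol': "B $$ (Suc i, 0) = 0" if "i < m" for i using Bcol[of "Suc i"] that by simp
  have Brow: "B $$ (0, Suc i) = 0" if "i < m" for i using Bsym[of 0 "Suc i"] Bcol'[OF that] that by simp
  obtain V k where V: "unitary_mat ?n V" "B = V * real_diag ?n k * mat_adjoint V"
    using hermitian_spectral_step[OF U(1) Bc B00 Brow Bcol' U(2)[unfolded C_def]] by blast
  have "A = W * B * mat_adjoint W"
  proof -
    have "W * B * mat_adjoint W = W * (mat_adjoint W * (A * (W * mat_adjoint W)))"
      using A Wc by (simp add: B_def assoc_mult_mat[of _ ?n ?n _ ?n _ ?n] mult_carrier_mat[of _ ?n ?n _ ?n])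
    also have "\<dots> = A" using A W Wc by (simp add: unitary_mat_def unitary_cancel(1)[OF W A])
    finally show ?thesis by simp
  qed
  also have "\<dots> = (W * V) * real_diag ?n k * mat_adjoint (W * V)"
    by (rule spec_unitary_congruence[OF V(1) Wc(1) V(2)])
  finally have "spec_decomp A (W * V) k"
    unfolding spec_decomp_iff[OF A] using W V(1) by auto
  then show ?case by blast
qed

section \<open>Positive semidefinite matrices\<close>

lemma psd_carrier: "psd n A \<Longrightarrow> A \<in> carrier_mat n n"
  by (simp add: psd_def)

lemma psd_quadratic:
  assumes "psd n A"
  shows "Im (\<Sum>i<n. \<Sum>j<n. cnj (f i) * A $$ (i, j) * f j) = 0"
    "0 \<le> Re (\<Sum>i<n. \<Sum>j<n. cnj (f i) * A $$ (i, j) * f j)"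
proof -
  have "let q = (\<Sum>i<n. \<Sum>j<n. cnj (vec n f $ i) * A $$ (i, j) * vec n f $ j) in Im q = 0 \<and> Re q \<ge> 0"
    using assms unfolding psd_def by (meson vec_carrier)
  then show "Im (\<Sum>i<n. \<Sum>j<n. cnj (f i) * A $$ (i, j) * f j) = 0"
    "0 \<le> Re (\<Sum>i<n. \<Sum>j<n. cnj (f i) * A $$ (i, j) * f j)"
    by (simp_all add: Let_def)
qed

text \<open>Polarisation with vectors supported on \<open>i\<close> and \<open>j\<close>, using only
  that the quadratic form is real.\<close>

lemma psd_hermitian_index:
  assumes A: "psd n A" and ij: "i < n" "j < n"
  shows "A $$ (i, j) = cnj (A $$ (j, i))"
proof -
  have real: "Im (cnj a * a * A $$ (i, i) + cnj a * b * A $$ (i, j) + cnj b * a * A $$ (j, i) + cnj b * b * A $$ (j, j)) = 0"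
    for a b
  proof -
    have s: "(\<Sum>k<n. cnj ((if k = i then a else 0) + (if k = j then b else 0)) * g k) = cnj a * g i + cnj b * g j" for g
    proof -
      have "(\<Sum>k<n. cnj ((if k = i then a else 0) + (if k = j then b else 0)) * g k)
          = (\<Sum>k<n. (if k = i then cnj a * g k else 0) + (if k = j then cnj b * g k else 0))"
        by (intro sum.cong) (auto simp: algebra_simps)
      then show ?thesis using ij by (simp add: sum.distrib)
    qed
    have s': "(\<Sum>k<n. g k * ((if k = i then a else 0) + (if k = j then b else 0))) = g i * a + g j * b" for g
    proof -
      have "(\<Sum>k<n. g k * ((if k = i then a else 0) + (if k = j then b else 0)))
          = (\<Sum>k<n. (if k = i then g k * a else 0) + (if k = j then g k * b else 0))"
        by (intro sum.cong) (auto simp: algebra_simps)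
      then show ?thesis using ij by (simp add: sum.distrib)
    qed
    have "Im (\<Sum>k<n. cnj ((if k = i then a else 0) + (if k = j then b else 0)) *
       (\<Sum>l<n. A $$ (k, l) * ((if l = i then a else 0) + (if l = j then b else 0)))) = 0"
      using psd_quadratic(1)[OF A, of "\<lambda>k. (if k = i then a else 0) + (if k = j then b else 0)"]
      by (simp only: sum_distrib_left mult.assoc)
    then show ?thesis unfolding s s' by (simp add: algebra_simps)
  qed
  \<comment> \<open>The first two choices make the diagonal entries real, the third gives opposite
    imaginary parts of the off-diagonal entries, the fourth equal real parts.\<close>
  from real[of 1 0] real[of 0 1] real[of 1 1] real[of 1 \<i>] show ?thesis
    by (simp add: complex_eq_iff)
qed

lemma psd_hermitian: "psd n A \<Longrightarrow> mat_adjoint A = A"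
  by (rule eq_matI) (auto simp: psd_def intro!: psd_hermitian_index[symmetric, of n])

text \<open>Entry \<open>(c, c)\<close> is the quadratic form of \<open>A\<close> at column
  \<open>c\<close> of \<open>Y\<close>.\<close>

lemma psd_congruence_diag:
  assumes A: "psd n A" and Y: "Y \<in> carrier_mat n m" and c: "c < m"
  shows "Im ((mat_adjoint Y * (A * Y)) $$ (c, c)) = 0" "0 \<le> Re ((mat_adjoint Y * (A * Y)) $$ (c, c))"
proof -
  have Ac: "A \<in> carrier_mat n n" using A by (rule psd_carrier)
  have AY: "A * Y \<in> carrier_mat n m" using Ac Y by auto
  have "(mat_adjoint Y * (A * Y)) $$ (c, c) = (\<Sum>i<n. mat_adjoint Y $$ (c, i) * (A * Y) $$ (i, c))"
    using Y AY c by (intro mult_mat_index_sum) auto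
  also have "\<dots> = (\<Sum>i<n. cnj (Y $$ (i, c)) * (\<Sum>j<n. A $$ (i, j) * Y $$ (j, c)))"
    using Y Ac c by (intro sum.cong) (auto simp: mult_mat_index_sum[OF Ac Y] simp del: index_mult_mat(1))
  also have "\<dots> = (\<Sum>i<n. \<Sum>j<n. cnj (Y $$ (i, c)) * A $$ (i, j) * Y $$ (j, c))"
    by (simp add: sum_distrib_left mult.assoc)
  finally show "Im ((mat_adjoint Y * (A * Y)) $$ (c, c)) = 0" "0 \<le> Re ((mat_adjoint Y * (A * Y)) $$ (c, c))"
    using psd_quadratic[OF A, of "\<lambda>i. Y $$ (i, c)"] by simp_all
qed

text \<open>The quadratic form at \<open>v\<close> collapses to the sum of
  \<open>l k * (cmod (z k))\<^sup>2\<close>, where \<open>z k\<close> pairs \<open>v\<close> with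
  \<open>g k\<close>. Using vectors \<open>g k\<close> instead of a matrix factor lets
  \<open>cptp_block\<close> stack two matrices by a case distinction on the index.\<close>

lemma psd_gramI:
  fixes l :: "'k \<Rightarrow> real"
  assumes A: "A \<in> carrier_mat n n" and l: "\<And>k. k \<in> K \<Longrightarrow> 0 \<le> l k"
    and A_eq: "\<And>i j. i < n \<Longrightarrow> j < n \<Longrightarrow> A $$ (i, j) = (\<Sum>k\<in>K. l k * (g k i * cnj (g k j)))"
  shows "psd n A"
  unfolding psd_def Let_def
proof (intro conjI ballI A)
  fix v :: "complex vec" assume "v \<in> carrier_vec n"
  define z where "z k = (\<Sum>i<n. cnj (v $ i) * g k i)" for k
  have "(\<Sum>i<n. \<Sum>j<n. cnj (v $ i) * A $$ (i, j) * v $ j)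
      = (\<Sum>i<n. \<Sum>j<n. \<Sum>k\<in>K. l k * ((cnj (v $ i) * g k i) * cnj (cnj (v $ j) * g k j)))"
    by (simp add: A_eq sum_distrib_left sum_distrib_right mult_ac)
  also have "\<dots> = (\<Sum>i<n. \<Sum>k\<in>K. \<Sum>j<n. l k * ((cnj (v $ i) * g k i) * cnj (cnj (v $ j) * g k j)))"
    by (intro sum.cong refl sum.swap)
  also have "\<dots> = (\<Sum>k\<in>K. \<Sum>i<n. \<Sum>j<n. l k * ((cnj (v $ i) * g k i) * cnj (cnj (v $ j) * g k j)))"
    by (rule sum.swap)
  also have "\<dots> = (\<Sum>k\<in>K. l k * (z k * cnj (z k)))"
  proof (rule sum.cong[OF refl])
    fix k assume "k \<in> K"
    have "z k * cnj (z k) = (\<Sum>i<n. \<Sum>j<n. (cnj (v $ i) * g k i) * cnj (cnj (v $ j) * g k j))"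
      unfolding z_def cnj_sum by (rule sum_product)
    then show "(\<Sum>i<n. \<Sum>j<n. l k * ((cnj (v $ i) * g k i) * cnj (cnj (v $ j) * g k j))) = l k * (z k * cnj (z k))"
      by (simp only: sum_distrib_left)
  qed
  also have "\<dots> = complex_of_real (\<Sum>k\<in>K. l k * (cmod (z k))\<^sup>2)"
    by (simp only: of_real_sum of_real_mult complex_norm_square)
  finally have q: "(\<Sum>i<n. \<Sum>j<n. cnj (v $ i) * A $$ (i, j) * v $ j) = complex_of_real (\<Sum>k\<in>K. l k * (cmod (z k))\<^sup>2)" .
  show "Im (\<Sum>i<n. \<Sum>j<n. cnj (v $ i) * A $$ (i, j) * v $ j) = 0" unfolding q by simp
  show "0 \<le> Re (\<Sum>i<n. \<Sum>j<n. cnj (v $ i) * A $$ (i, j) * v $ j)"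
    unfolding q using l by (simp add: sum_nonneg)
qed

lemma psd_spectral:
  assumes A: "psd n A"
  shows "\<exists>U l. spec_decomp A U l \<and> (\<forall>i. 0 \<le> l i)"
proof -
  have Ac: "A \<in> carrier_mat n n" using A by (rule psd_carrier)
  obtain U l where "spec_decomp A U l"
    using hermitian_spectral[OF Ac psd_hermitian[OF A]] by blast
  then have U: "unitary_mat n U" and A_eq: "A = U * real_diag n l * mat_adjoint U"
    using Ac by (auto simp: spec_decomp_def)
  have Uc: "U \<in> carrier_mat n n" "mat_adjoint U \<in> carrier_mat n n" using U by auto
  have "mat_adjoint U * (A * U) = real_diag n l"
    using U Uc by (simp add: A_eq assoc_mult_mat[of _ n n _ n _ n] mult_carrier_mat[of _ n n _ n] unitary_cancel[of n _ _ n])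
      (simp add: unitary_mat_def)
  then have l: "0 \<le> l i" if "i < n" for i
    using psd_congruence_diag(2)[OF A Uc(1) that] that by (simp add: real_diag_index)
  \<comment> \<open>Values from index \<open>n\<close> on do not enter \<open>real_diag n\<close>;
    setting them to zero makes nonnegativity unconditional.\<close>
  define k where "k i = (if i < n then l i else 0)" for i
  have "real_diag n k = real_diag n l" by (rule eq_matI) (auto simp: real_diag_index k_def)
  then have "spec_decomp A U k" unfolding spec_decomp_iff[OF Ac] using U A_eq by simp
  moreover have "\<forall>i. 0 \<le> k i" using l by (simp add: k_def)
  ultimately show ?thesis by blast
qed

subsection \<open>Traces of products of matrix powers\<close>

text \<open>The Petz quasi-entropy, the quantity raised to the power \<beta> in
  \<open>D_ab\<close>.\<close>

definition petz :: "real \<Rightarrow> complex mat \<Rightarrow> complex mat \<Rightarrow> real" where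
  "petz \<alpha> \<rho> \<sigma> = Re (mtrace (mat_powr \<rho> \<alpha> * mat_powr \<sigma> (1 - \<alpha>)))"

definition overlap :: "complex mat \<Rightarrow> complex mat \<Rightarrow> nat \<Rightarrow> nat \<Rightarrow> real" where
  "overlap U V i j = (cmod ((mat_adjoint U * V) $$ (i, j)))\<^sup>2"

lemma overlap_nonneg [simp]: "0 \<le> overlap U V i j"
  by (simp add: overlap_def)

lemma overlap_row_sum: "unitary_mat n U \<Longrightarrow> unitary_mat n V \<Longrightarrow> i < n \<Longrightarrow> (\<Sum>j<n. overlap U V i j) = 1"
  unfolding overlap_def by (intro unitary_row_sum) auto

lemma overlap_col_sum: "unitary_mat n U \<Longrightarrow> unitary_mat n V \<Longrightarrow> j < n \<Longrightarrow> (\<Sum>i<n. overlap U V i j) = 1"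
  unfolding overlap_def by (intro unitary_col_sum) auto

lemma mtrace_real_diag_mult:
  assumes "A \<in> carrier_mat n n"
  shows "mtrace (real_diag n d * A) = (\<Sum>i<n. d i * A $$ (i, i))"
  unfolding mtrace_def using assms
  by (intro sum.cong) (auto simp: real_diag_mult_left_index[OF assms] simp del: index_mult_mat(1))

lemma mtrace_spec:
  assumes U: "unitary_mat n U"
  shows "mtrace (U * real_diag n d * mat_adjoint U) = complex_of_real (\<Sum>i<n. d i)"
proof -
  have c: "U \<in> carrier_mat n n" "mat_adjoint U \<in> carrier_mat n n" using U by auto
  have "mtrace (U * real_diag n d * mat_adjoint U) = mtrace (mat_adjoint U * (U * real_diag n d))"
    using c by (intro mtrace_comm[of _ n n]) auto
  also have "mat_adjoint U * (U * real_diag n d) = real_diag n d"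
    using U by (intro unitary_cancel) auto
  also have "mtrace (real_diag n d) = complex_of_real (\<Sum>i<n. d i)"
    by (simp add: mtrace_def real_diag_index)
  finally show ?thesis .
qed

text \<open>Cyclicity brings the trace to that of
  \<open>real_diag n d * (W * real_diag n e * mat_adjoint W)\<close> with
  \<open>W = mat_adjoint U * V\<close>, whose diagonal involves only the squared moduli of the
  entries of \<open>W\<close>.\<close>

lemma mtrace_spec_mult_spec:
  assumes U: "U \<in> carrier_mat n n" and V: "V \<in> carrier_mat n n"
  shows "mtrace (U * real_diag n d * mat_adjoint U * (V * real_diag n e * mat_adjoint V))
    = complex_of_real (\<Sum>i<n. \<Sum>j<n. overlap U V i j * (d i * e j))"
proof -
  note mc = assoc_mult_mat[of _ n n _ n _ n] mult_carrier_mat[of _ n n _ n]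
  have c: "mat_adjoint U \<in> carrier_mat n n" "mat_adjoint V \<in> carrier_mat n n" using U V by auto
  define W where "W = mat_adjoint U * V"
  have Wc: "W \<in> carrier_mat n n" using V c by (auto simp: W_def)
  have Wa: "mat_adjoint W = mat_adjoint V * U" using V c by (simp add: W_def mat_adjoint_mult[of _ n n _ n])
  have "mtrace (U * real_diag n d * mat_adjoint U * (V * real_diag n e * mat_adjoint V))
      = mtrace (U * (real_diag n d * mat_adjoint U * (V * real_diag n e * mat_adjoint V)))"
    using U V c by (simp add: mc)
  also have "\<dots> = mtrace (real_diag n d * mat_adjoint U * (V * real_diag n e * mat_adjoint V) * U)"
    using U V c by (intro mtrace_comm[of _ n n]) (auto simp: mc)
  also have "real_diag n d * mat_adjoint U * (V * real_diag n e * mat_adjoint V) * U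
      = real_diag n d * (W * real_diag n e * mat_adjoint W)"
    using U V c by (simp add: mc W_def[symmetric] Wa) (simp add: mc W_def)
  also have "mtrace \<dots> = (\<Sum>i<n. d i * (\<Sum>j<n. e j * (W $$ (i, j) * cnj (W $$ (i, j)))))"
    using Wc by (subst mtrace_real_diag_mult) (auto simp: mult_diag_adjoint_index[OF Wc Wc] simp del: index_mult_mat(1))
  also have "\<dots> = complex_of_real (\<Sum>i<n. \<Sum>j<n. overlap U V i j * (d i * e j))"
    unfolding overlap_def of_real_sum of_real_mult complex_norm_square W_def[symmetric] sum_distrib_left
    by (simp add: mult_ac)
  finally show ?thesis .
qed

lemma petz_eq:
  assumes c: "\<rho> \<in> carrier_mat n n" "\<sigma> \<in> carrier_mat n n"
    and \<rho>: "spec_decomp \<rho> U r" and \<sigma>: "spec_decomp \<sigma> V t"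
  shows "petz \<alpha> \<rho> \<sigma> = (\<Sum>i<n. \<Sum>j<n. overlap U V i j * (r i powr \<alpha> * t j powr (1 - \<alpha>)))"
proof -
  have "U \<in> carrier_mat n n" "V \<in> carrier_mat n n"
    using \<rho> \<sigma> c by (auto simp: spec_decomp_iff)
  then show ?thesis
    unfolding petz_def mat_powr_eq[OF c(1) \<rho>] mat_powr_eq[OF c(2) \<sigma>]
    by (subst mtrace_spec_mult_spec) simp_all
qed

text \<open>In a foreign eigenbasis the diagonal of \<open>A\<close> averages its eigenvalues with
  the overlaps as weights. This relates a zero eigenvalue of the midpoint to the spectrum of \<rho>
  in \<open>support_overlap\<close>.\<close>

lemma diag_congruence_spec:
  assumes U: "unitary_mat n U" and V: "unitary_mat n V" and A: "A = U * real_diag n r * mat_adjoint U" and j: "j < n"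
  shows "(mat_adjoint V * (A * V)) $$ (j, j) = complex_of_real (\<Sum>i<n. overlap U V i j * r i)"
proof -
  note mc = assoc_mult_mat[of _ n n _ n _ n] mult_carrier_mat[of _ n n _ n]
  have c: "U \<in> carrier_mat n n" "V \<in> carrier_mat n n"
     "mat_adjoint U \<in> carrier_mat n n" "mat_adjoint V \<in> carrier_mat n n" using U V by auto
  have Ac: "A \<in> carrier_mat n n" using c by (auto simp: A)
  define W where "W = mat_adjoint V * U"
  have Wc: "W \<in> carrier_mat n n" using c by (auto simp: W_def)
  have Wa: "mat_adjoint U * V = mat_adjoint W" using c by (simp add: W_def mat_adjoint_mult[of _ n n _ n])
  have "mat_adjoint V * (A * V) = W * real_diag n r * mat_adjoint W"
    using spec_unitary_congruence[OF U c(4) A] c Ac by (simp add: mc W_def)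
  then have "(mat_adjoint V * (A * V)) $$ (j, j) = (\<Sum>i<n. r i * (W $$ (j, i) * cnj (W $$ (j, i))))"
    using mult_diag_adjoint_index[OF Wc Wc j j] by simp
  also have "\<dots> = complex_of_real (\<Sum>i<n. overlap U V i j * r i)"
    unfolding overlap_def of_real_sum of_real_mult complex_norm_square Wa
    using Wc j by (intro sum.cong) (auto simp: mult_ac)
  finally show ?thesis .
qed

lemma overlap_self:
  assumes "unitary_mat n V" "i < n" "j < n"
  shows "overlap V V i j = (if i = j then 1 else 0)"
  using assms by (simp add: overlap_def unitary_mat_def)

lemma diag_congruence_self:
  assumes V: "unitary_mat n V" and A: "A = V * real_diag n t * mat_adjoint V" and j: "j < n"
  shows "(mat_adjoint V * (A * V)) $$ (j, j) = complex_of_real (t j)"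
proof -
  have "(\<Sum>i<n. overlap V V i j * t i) = (\<Sum>i<n. if i = j then t i else 0)"
    using overlap_self[OF V _ j] by (intro sum.cong) auto
  then show ?thesis
    unfolding diag_congruence_spec[OF V V A j] using j by simp
qed

text \<open>\<open>t j\<close> is half the sum of the diagonal entries of \<rho> and \<sigma> at
  eigenvector \<open>j\<close> of the midpoint. Both are nonnegative, so both vanish with
  \<open>t j\<close>; the entry of \<rho> is a sum of the nonnegative terms
  \<open>overlap U V i j * r i\<close>.\<close>

lemma support_overlap:
  assumes \<rho>: "psd n \<rho>" and \<sigma>: "psd n \<sigma>"
    and U: "spec_decomp \<rho> U r" and r: "\<And>i. 0 \<le> r i" and V: "spec_decomp ((1/2) \<cdot>\<^sub>m (\<rho> + \<sigma>)) V t"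
    and ij: "i < n" "j < n" and tj: "t j = 0"
  shows "overlap U V i j = 0 \<or> r i = 0"
proof -
  have c: "\<rho> \<in> carrier_mat n n" "\<sigma> \<in> carrier_mat n n" using \<rho> \<sigma> by (auto simp: psd_carrier)
  then have mc: "(1/2) \<cdot>\<^sub>m (\<rho> + \<sigma>) \<in> carrier_mat n n" by auto
  have U': "unitary_mat n U" "\<rho> = U * real_diag n r * mat_adjoint U" using U spec_decomp_iff[OF c(1)] by auto
  have V': "unitary_mat n V" "(1/2) \<cdot>\<^sub>m (\<rho> + \<sigma>) = V * real_diag n t * mat_adjoint V"
    using V spec_decomp_iff[OF mc] by auto
  have Vc: "V \<in> carrier_mat n n" "mat_adjoint V \<in> carrier_mat n n" using V' by auto
  have "mat_adjoint V * (((1/2) \<cdot>\<^sub>m (\<rho> + \<sigma>)) * V) = (1/2) \<cdot>\<^sub>m (mat_adjoint V * (\<rho> * V) + mat_adjoint V * (\<sigma> * V))"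
    using c Vc by (simp add: add_mult_distrib_mat[of _ n n _ _ n] mult_add_distrib_mat[of _ n n _ n] mult_smult_assoc_mat[of _ n n _ n]
        mult_smult_distrib[of _ n n _ n] mult_carrier_mat[of _ n n _ n] add_carrier_mat[of _ n n])
  then have "complex_of_real (t j) = ((1/2) \<cdot>\<^sub>m (mat_adjoint V * (\<rho> * V) + mat_adjoint V * (\<sigma> * V))) $$ (j, j)"
    using diag_congruence_self[OF V' ij(2)] by simp
  also have "\<dots> = ((mat_adjoint V * (\<rho> * V)) $$ (j, j) + (mat_adjoint V * (\<sigma> * V)) $$ (j, j)) / 2"
    using c Vc ij by (simp del: index_mult_mat(1))
  finally have "Re ((mat_adjoint V * (\<rho> * V)) $$ (j, j)) + Re ((mat_adjoint V * (\<sigma> * V)) $$ (j, j)) = 0"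
    using tj by (metis (no_types, lifting) div_0 divide_eq_0_iff of_real_0 plus_complex.sel(1) zero_complex.sel(1) zero_neq_numeral)
  then have "Re ((mat_adjoint V * (\<rho> * V)) $$ (j, j)) = 0"
    using psd_congruence_diag(2)[OF \<rho> Vc(1) ij(2)] psd_congruence_diag(2)[OF \<sigma> Vc(1) ij(2)] by linarith
  then have "(\<Sum>i<n. overlap U V i j * r i) = 0"
    unfolding diag_congruence_spec[OF U'(1) V'(1) U'(2) ij(2)] by simp
  then show ?thesis
    using ij r by (subst (asm) sum_nonneg_eq_0_iff) auto
qed

subsection \<open>Overlapping classical distributions\<close>

text \<open>Apply \<open>ln x \<le> x - 1\<close> at \<open>r / A\<close> and \<open>t / A\<close>,
  with \<open>A\<close> the weighted arithmetic mean: the right-hand sides average to zero, and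
  \<open>r \<noteq> A\<close> makes the first bound strict.\<close>

lemma young_strict:
  fixes \<alpha> r t :: real
  assumes "0 < \<alpha>" "\<alpha> < 1" "0 < r" "0 < t" "r \<noteq> t"
  shows "r powr \<alpha> * t powr (1 - \<alpha>) < \<alpha> * r + (1 - \<alpha>) * t"
proof -
  define A where "A = \<alpha> * r + (1 - \<alpha>) * t"
  have A: "0 < A" unfolding A_def using assms by (intro add_pos_pos mult_pos_pos) auto
  have "r - A = (1 - \<alpha>) * (r - t)" by (simp add: A_def algebra_simps)
  then have "r \<noteq> A" using assms by auto
  have "ln (r / A) < r / A - 1"
    using ln_le_minus_one[of "r / A"] ln_eq_minus_one[of "r / A"] A \<open>r \<noteq> A\<close> assms by fastforce
  moreover have "ln (t / A) \<le> t / A - 1" using A assms by (intro ln_le_minus_one) simp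
  ultimately have "\<alpha> * ln (r / A) + (1 - \<alpha>) * ln (t / A) < \<alpha> * (r / A - 1) + (1 - \<alpha>) * (t / A - 1)"
    using assms by (intro add_less_le_mono mult_strict_left_mono mult_left_mono) auto
  also have "\<dots> = 0" using A by (simp add: field_simps) (simp add: A_def algebra_simps)
  finally have "\<alpha> * ln r + (1 - \<alpha>) * ln t < ln A"
    using A assms by (simp add: ln_div algebra_simps)
  then have "exp (\<alpha> * ln r + (1 - \<alpha>) * ln t) < A" using A by (metis exp_less_mono exp_ln)
  then show ?thesis using assms by (simp add: powr_def exp_add A_def)
qed

lemma young_le:
  fixes \<alpha> r t :: real
  assumes "0 < \<alpha>" "\<alpha> < 1" "0 \<le> r" "0 \<le> t"
  shows "r powr \<alpha> * t powr (1 - \<alpha>) \<le> \<alpha> * r + (1 - \<alpha>) * t"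
    "r powr \<alpha> * t powr (1 - \<alpha>) = \<alpha> * r + (1 - \<alpha>) * t \<Longrightarrow> r = t"
proof -
  have d: "r powr \<alpha> * t powr (1 - \<alpha>) < \<alpha> * r + (1 - \<alpha>) * t \<or> r = t"
    using young_strict[of \<alpha> r t] assms by (cases "r = 0"; cases "t = 0") auto
  moreover have "r powr \<alpha> * t powr (1 - \<alpha>) = \<alpha> * r + (1 - \<alpha>) * t" if "r = t"
    using that assms by (simp add: powr_add[symmetric] algebra_simps)
  ultimately show "r powr \<alpha> * t powr (1 - \<alpha>) \<le> \<alpha> * r + (1 - \<alpha>) * t" by fastforce
  show "r powr \<alpha> * t powr (1 - \<alpha>) = \<alpha> * r + (1 - \<alpha>) * t \<Longrightarrow> r = t" using d by auto
qed

text \<open>\<open>r\<close> is the weighted geometric mean, with exponent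
  \<open>1/\<alpha>\<close>, of \<open>C = r powr \<alpha> * t powr (1 - \<alpha>)\<close> and
  \<open>t\<close>; the ordinary Young inequality for that mean rearranges to the reversed one. At
  \<open>t = 0\<close> the convention \<open>0 powr a = 0\<close> would falsify it for positive
  \<open>r\<close>.\<close>

lemma young_ge:
  fixes \<alpha> r t :: real
  assumes \<alpha>: "1 < \<alpha>" and rt: "0 \<le> r" "0 < t"
  shows "\<alpha> * r + (1 - \<alpha>) * t \<le> r powr \<alpha> * t powr (1 - \<alpha>)"
    "r powr \<alpha> * t powr (1 - \<alpha>) = \<alpha> * r + (1 - \<alpha>) * t \<Longrightarrow> r = t"
proof -
  define C where "C = r powr \<alpha> * t powr (1 - \<alpha>)"
  have C: "0 \<le> C" by (simp add: C_def)
  have e: "C powr (1/\<alpha>) * t powr (1 - 1/\<alpha>) = r"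
  proof -
    have "C powr (1/\<alpha>) = r * t powr ((1 - \<alpha>) / \<alpha>)"
      using assms by (simp add: C_def powr_mult powr_powr)
    then have "C powr (1/\<alpha>) * t powr (1 - 1/\<alpha>) = r * (t powr ((1 - \<alpha>) / \<alpha>) * t powr (1 - 1/\<alpha>))" by simp
    also have "t powr ((1 - \<alpha>) / \<alpha>) * t powr (1 - 1/\<alpha>) = 1"
      using assms by (simp add: powr_add[symmetric] field_simps)
    finally show ?thesis by simp
  qed
  have a: "0 < 1/\<alpha>" "1/\<alpha> < 1" using \<alpha> by auto
  note y = young_le[OF a C less_imp_le[OF rt(2)], unfolded e]
  have sc: "\<alpha> * (1 / \<alpha> * C + (1 - 1 / \<alpha>) * t) = C + (\<alpha> - 1) * t" using \<alpha> by (simp add: field_simps)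
  have "\<alpha> * r \<le> \<alpha> * (1 / \<alpha> * C + (1 - 1 / \<alpha>) * t)" using y(1) \<alpha> by (intro mult_left_mono) auto
  then show "\<alpha> * r + (1 - \<alpha>) * t \<le> r powr \<alpha> * t powr (1 - \<alpha>)"
    unfolding sc C_def[symmetric] by (simp add: algebra_simps)
  show "r = t" if "r powr \<alpha> * t powr (1 - \<alpha>) = \<alpha> * r + (1 - \<alpha>) * t"
  proof -
    have "\<alpha> * r = \<alpha> * (1 / \<alpha> * C + (1 - 1 / \<alpha>) * t)"
      unfolding sc using that by (simp add: C_def algebra_simps)
    then have "r = 1 / \<alpha> * C + (1 - 1 / \<alpha>) * t" using \<alpha> by simp
    then have "C = t" by (rule y(2))
    then have "r = t powr (1 / \<alpha>) * t powr (1 - 1 / \<alpha>)" using e by simp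
    then show ?thesis using rt by (simp add: powr_add[symmetric])
  qed
qed

lemma double_sum_nonneg_eq_0:
  fixes f :: "nat \<Rightarrow> nat \<Rightarrow> real"
  assumes "\<And>i j. i < n \<Longrightarrow> j < n \<Longrightarrow> 0 \<le> f i j" and "(\<Sum>i<n. \<Sum>j<n. f i j) = 0" and "i < n" "j < n"
  shows "f i j = 0"
proof -
  have "(\<Sum>j<n. f i j) = 0"
    using assms by (subst (asm) sum_nonneg_eq_0_iff) (auto intro: sum_nonneg)
  then show ?thesis using assms by (subst (asm) sum_nonneg_eq_0_iff) auto
qed

text \<open>The products \<open>w i j * r i\<close> and \<open>w i j * t j\<close> are the
  Nussbaum-Szkola distributions of a pair of states: two classical distributions on index pairs. The
  last assumption says that the first is absolutely continuous with respect to the second.\<close>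

locale overlapping_distributions =
  fixes n :: nat and w :: "nat \<Rightarrow> nat \<Rightarrow> real" and r t :: "nat \<Rightarrow> real"
  assumes w_nonneg: "\<And>i j. 0 \<le> w i j"
    and w_row: "\<And>i. i < n \<Longrightarrow> (\<Sum>j<n. w i j) = 1" and w_col: "\<And>j. j < n \<Longrightarrow> (\<Sum>i<n. w i j) = 1"
    and r_nonneg: "\<And>i. 0 \<le> r i" and t_nonneg: "\<And>j. 0 \<le> t j"
    and r_sum: "(\<Sum>i<n. r i) = 1" and t_sum: "(\<Sum>j<n. t j) = 1"
    and support: "\<And>i j. i < n \<Longrightarrow> j < n \<Longrightarrow> t j = 0 \<Longrightarrow> w i j = 0 \<or> r i = 0"
begin

definition "Q \<alpha> = (\<Sum>i<n. \<Sum>j<n. w i j * (r i powr \<alpha> * t j powr (1 - \<alpha>)))"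

lemma sum_w_r: "(\<Sum>i<n. \<Sum>j<n. w i j * r i) = 1"
  using w_row r_sum by (simp add: sum_distrib_right[symmetric])

lemma sum_w_t: "(\<Sum>i<n. \<Sum>j<n. w i j * t j) = 1"
  by (subst sum.swap) (use w_col t_sum in \<open>simp add: sum_distrib_right[symmetric]\<close>)

text \<open>The arithmetic side of Young's inequality has total mass one for every \<alpha>, hence
  the bound one for \<open>Q\<close>.\<close>

lemma sum_w_affine: "(\<Sum>i<n. \<Sum>j<n. w i j * (\<alpha> * r i + (1 - \<alpha>) * t j)) = 1"
proof -
  have "w i j * (\<alpha> * r i + (1 - \<alpha>) * t j) = \<alpha> * (w i j * r i) + (1 - \<alpha>) * (w i j * t j)" for i j
    by (simp add: algebra_simps)
  then have "(\<Sum>i<n. \<Sum>j<n. w i j * (\<alpha> * r i + (1 - \<alpha>) * t j))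
     = \<alpha> * (\<Sum>i<n. \<Sum>j<n. w i j * r i) + (1 - \<alpha>) * (\<Sum>i<n. \<Sum>j<n. w i j * t j)"
    by (simp only: sum.distrib sum_distrib_left)
  then show ?thesis unfolding sum_w_r sum_w_t by simp
qed

text \<open>If \<open>Q \<alpha>\<close> vanished, so would every term; with the support condition
  this kills every \<open>w i j * r i\<close>, whose total is one.\<close>

lemma Q_pos: "0 < Q \<alpha>"
proof -
  have "0 \<le> Q \<alpha>" unfolding Q_def by (intro sum_nonneg mult_nonneg_nonneg w_nonneg) auto
  moreover have "Q \<alpha> \<noteq> 0"
  proof
    assume "Q \<alpha> = 0"
    then have z: "w i j * (r i powr \<alpha> * t j powr (1 - \<alpha>)) = 0" if "i < n" "j < n" for i j
      using double_sum_nonneg_eq_0[of n "\<lambda>i j. w i j * (r i powr \<alpha> * t j powr (1 - \<alpha>))" i j] that w_nonneg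
      by (simp add: Q_def)
    have "w i j * r i = 0" if "i < n" "j < n" for i j
      using z[OF that] support[OF that] by auto
    then have "(\<Sum>i<n. \<Sum>j<n. w i j * r i) = 0" by (intro sum.neutral ballI) auto
    then show False using sum_w_r by simp
  qed
  ultimately show ?thesis by simp
qed

text \<open>\<open>1 - Q \<alpha>\<close> is the total of the nonnegative termwise gaps in Young's
  inequality. If it is zero, every gap of nonzero weight closes, which is the condition that
  \<open>spec_eq_iff\<close> asks for.\<close>

lemma Q_le_1:
  assumes \<alpha>: "0 < \<alpha>" "\<alpha> < 1"
  shows "Q \<alpha> \<le> 1" "Q \<alpha> = 1 \<Longrightarrow> i < n \<Longrightarrow> j < n \<Longrightarrow> w i j \<noteq> 0 \<Longrightarrow> r i = t j"
proof -
  define f where "f i j = w i j * ((\<alpha> * r i + (1 - \<alpha>) * t j) - r i powr \<alpha> * t j powr (1 - \<alpha>))" for i j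
  have f: "0 \<le> f i j" for i j
    unfolding f_def using young_le(1)[OF \<alpha> r_nonneg t_nonneg] w_nonneg by (simp add: mult_nonneg_nonneg)
  have s: "(\<Sum>i<n. \<Sum>j<n. f i j) = 1 - Q \<alpha>"
    by (subst sum_w_affine[symmetric, of \<alpha>], unfold f_def Q_def, subst right_diff_distrib) (simp only: sum_subtractf)
  show "Q \<alpha> \<le> 1" using s f by (metis diff_ge_0_iff_ge sum_nonneg)
  show "r i = t j" if "Q \<alpha> = 1" "i < n" "j < n" "w i j \<noteq> 0"
    using double_sum_nonneg_eq_0[of n f i j] f s that young_le(2)[OF \<alpha> r_nonneg t_nonneg] by (simp add: f_def)
qed

lemma Q_ge_1:
  assumes \<alpha>: "1 < \<alpha>"
  shows "1 \<le> Q \<alpha>" "Q \<alpha> = 1 \<Longrightarrow> i < n \<Longrightarrow> j < n \<Longrightarrow> w i j \<noteq> 0 \<Longrightarrow> r i = t j"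
proof -
  define f where "f i j = w i j * (r i powr \<alpha> * t j powr (1 - \<alpha>) - (\<alpha> * r i + (1 - \<alpha>) * t j))" for i j
  have f: "0 \<le> f i j" if "i < n" "j < n" for i j
  proof (cases "t j = 0")
    case True
    then show ?thesis using support[OF that] by (auto simp: f_def)
  next
    case False
    then show ?thesis
      unfolding f_def using young_ge(1)[OF \<alpha> r_nonneg, of "t j"] t_nonneg[of j] w_nonneg
      by (simp add: mult_nonneg_nonneg)
  qed
  have s: "(\<Sum>i<n. \<Sum>j<n. f i j) = Q \<alpha> - 1"
    by (subst sum_w_affine[symmetric, of \<alpha>], unfold f_def Q_def, subst right_diff_distrib) (simp only: sum_subtractf)
  have "0 \<le> (\<Sum>i<n. \<Sum>j<n. f i j)" using f by (intro sum_nonneg) auto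
  then show "1 \<le> Q \<alpha>" using s by simp
  show "r i = t j" if "Q \<alpha> = 1" "i < n" "j < n" "w i j \<noteq> 0"
  proof (cases "t j = 0")
    case True
    then show ?thesis using support[OF that(2,3)] that by auto
  next
    case False
    then show ?thesis
      using double_sum_nonneg_eq_0[of n f i j] f s that young_ge(2)[OF \<alpha> r_nonneg, of "t j"] t_nonneg[of j]
      by (simp add: f_def)
  qed
qed

end

subsection \<open>Comparing a state with a midpoint\<close>

lemma density_carrier: "density n \<rho> \<Longrightarrow> \<rho> \<in> carrier_mat n n"
  by (simp add: density_def psd_carrier)

lemma density_spectral:
  assumes \<rho>: "density n \<rho>"
  obtains U r where "spec_decomp \<rho> U r" "unitary_mat n U" "\<rho> = U * real_diag n r * mat_adjoint U"
    "\<And>i. 0 \<le> r i" "(\<Sum>i<n. r i) = 1"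
proof -
  obtain U r where Ur: "spec_decomp \<rho> U r" "\<forall>i. 0 \<le> r i"
    using psd_spectral[of n \<rho>] \<rho> by (auto simp: density_def)
  then have U: "unitary_mat n U" "\<rho> = U * real_diag n r * mat_adjoint U"
    using spec_decomp_iff[OF density_carrier[OF \<rho>]] by auto
  then have "complex_of_real (\<Sum>i<n. r i) = 1"
    using mtrace_spec[OF U(1), of r] \<rho> by (simp add: density_def)
  then have "(\<Sum>i<n. r i) = 1" by (metis of_real_eq_1_iff)
  with Ur U that show ?thesis by blast
qed

section \<open>Mixtures and midpoints of states\<close>

lemma mix_carrier [simp]: "mix n J p \<rho> \<in> carrier_mat n n"
  by (simp add: mix_def)

lemma psd_mix:
  assumes p: "\<And>j. j \<in> J \<Longrightarrow> 0 \<le> p j" and \<rho>: "\<And>j. j \<in> J \<Longrightarrow> psd n (\<rho> j)"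
  shows "psd n (mix n J p \<rho>)"
  unfolding psd_def Let_def
proof (intro conjI ballI)
  fix v :: "complex vec" assume v: "v \<in> carrier_vec n"
  let ?q = "\<lambda>A. \<Sum>a<n. \<Sum>b<n. cnj (v $ a) * A $$ (a, b) * v $ b"
  have "?q (mix n J p \<rho>) = (\<Sum>a<n. \<Sum>b<n. \<Sum>j\<in>J. p j * (cnj (v $ a) * \<rho> j $$ (a, b) * v $ b))"
    by (simp add: mix_def sum_distrib_left sum_distrib_right mult_ac)
  also have "\<dots> = (\<Sum>a<n. \<Sum>j\<in>J. \<Sum>b<n. p j * (cnj (v $ a) * \<rho> j $$ (a, b) * v $ b))"
    by (intro sum.cong refl sum.swap)
  also have "\<dots> = (\<Sum>j\<in>J. \<Sum>a<n. \<Sum>b<n. p j * (cnj (v $ a) * \<rho> j $$ (a, b) * v $ b))"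
    by (rule sum.swap)
  also have "\<dots> = (\<Sum>j\<in>J. p j * ?q (\<rho> j))" by (simp only: sum_distrib_left)
  finally have q: "?q (mix n J p \<rho>) = (\<Sum>j\<in>J. p j * ?q (\<rho> j))" .
  have "Im (complex_of_real (p j) * ?q (\<rho> j)) = 0 \<and> 0 \<le> Re (complex_of_real (p j) * ?q (\<rho> j))" if "j \<in> J" for j
    using psd_quadratic[OF \<rho>[OF that], of "\<lambda>a. v $ a"] p[OF that] by simp
  then show "Im (?q (mix n J p \<rho>)) = 0" "0 \<le> Re (?q (mix n J p \<rho>))"
    unfolding q Im_sum Re_sum by (auto intro!: sum_nonneg sum.neutral)
qed simp

lemma mtrace_mix:
  assumes "\<And>j. j \<in> J \<Longrightarrow> \<rho> j \<in> carrier_mat n n"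
  shows "mtrace (mix n J p \<rho>) = (\<Sum>j\<in>J. p j * mtrace (\<rho> j))"
proof -
  have "mtrace (mix n J p \<rho>) = (\<Sum>j\<in>J. \<Sum>i<n. p j * \<rho> j $$ (i, i))"
    by (subst sum.swap) (simp add: mtrace_def mix_def)
  moreover have "mtrace (\<rho> j) = (\<Sum>i<n. \<rho> j $$ (i, i))" if "j \<in> J" for j
    using assms[OF that] by (simp add: mtrace_def)
  ultimately show ?thesis by (simp add: sum_distrib_left)
qed

lemma density_mix:
  assumes p: "\<And>j. j \<in> J \<Longrightarrow> 0 \<le> p j" "(\<Sum>j\<in>J. p j) = 1" and \<rho>: "\<And>j. j \<in> J \<Longrightarrow> density n (\<rho> j)"
  shows "density n (mix n J p \<rho>)"
proof -
  have "mtrace (mix n J p \<rho>) = complex_of_real (\<Sum>j\<in>J. p j)"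
    using \<rho> by (subst mtrace_mix) (auto simp: density_carrier density_def)
  then show ?thesis using psd_mix[of J p n \<rho>] p \<rho> by (simp add: density_def)
qed

abbreviation midpoint_mat :: "complex mat \<Rightarrow> complex mat \<Rightarrow> complex mat" where
  "midpoint_mat \<rho> \<sigma> \<equiv> (1/2) \<cdot>\<^sub>m (\<rho> + \<sigma>)"

lemma density_midpoint:
  assumes "density n \<rho>" "density n \<sigma>"
  shows "density n (midpoint_mat \<rho> \<sigma>)"
proof -
  have "midpoint_mat \<rho> \<sigma> = mix n {False, True} (\<lambda>_. 1/2) (\<lambda>b. if b then \<sigma> else \<rho>)"
    using assms by (intro eq_matI) (auto simp: mix_def algebra_simps dest!: density_carrier)
  then show ?thesis using assms by (auto intro!: density_mix)
qed

lemma midpoint_comm: "density n \<rho> \<Longrightarrow> density n \<sigma> \<Longrightarrow> midpoint_mat \<sigma> \<rho> = midpoint_mat \<rho> \<sigma>"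
  using comm_add_mat[of \<rho> n n \<sigma>] by (simp add: density_carrier)

lemma overlapping_midpoint:
  assumes \<rho>: "density n \<rho>" and \<sigma>: "density n \<sigma>"
  obtains U V r t where "unitary_mat n U" "unitary_mat n V"
    "\<rho> = U * real_diag n r * mat_adjoint U" "midpoint_mat \<rho> \<sigma> = V * real_diag n t * mat_adjoint V"
    "overlapping_distributions n (overlap U V) r t"
    "\<And>\<alpha>. petz \<alpha> \<rho> (midpoint_mat \<rho> \<sigma>) = overlapping_distributions.Q n (overlap U V) r t \<alpha>"
proof -
  note M = density_midpoint[OF \<rho> \<sigma>]
  obtain U r where U: "spec_decomp \<rho> U r" "unitary_mat n U" "\<rho> = U * real_diag n r * mat_adjoint U"
    "\<And>i. 0 \<le> r i" "(\<Sum>i<n. r i) = 1" using density_spectral[OF \<rho>] by blast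
  obtain V t where V: "spec_decomp (midpoint_mat \<rho> \<sigma>) V t" "unitary_mat n V"
    "midpoint_mat \<rho> \<sigma> = V * real_diag n t * mat_adjoint V"
    "\<And>i. 0 \<le> t i" "(\<Sum>i<n. t i) = 1" using density_spectral[OF M] by blast
  interpret overlapping_distributions n "overlap U V" r t
    using U V support_overlap[of n \<rho> \<sigma> U r V t] \<rho> \<sigma>
    by unfold_locales (auto simp: overlap_row_sum overlap_col_sum density_def)
  have "petz \<alpha> \<rho> (midpoint_mat \<rho> \<sigma>) = Q \<alpha>" for \<alpha>
    unfolding Q_def by (rule petz_eq[OF density_carrier[OF \<rho>] density_carrier[OF M] U(1) V(1)])
  with that U(2,3) V(2,3) overlapping_distributions_axioms show ?thesis by blast
qed

text \<open>Relative to a single eigenbasis the overlaps form the identity matrix, and the two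
  exponents add up to one.\<close>

lemma petz_self:
  assumes \<rho>: "density n \<rho>"
  shows "petz \<alpha> \<rho> \<rho> = 1"
proof -
  obtain U r where U: "spec_decomp \<rho> U r" "unitary_mat n U" "\<And>i. 0 \<le> r i" "(\<Sum>i<n. r i) = 1"
    using density_spectral[OF \<rho>] by blast
  have "petz \<alpha> \<rho> \<rho> = (\<Sum>i<n. \<Sum>j<n. overlap U U i j * (r i powr \<alpha> * r j powr (1 - \<alpha>)))"
    by (rule petz_eq[OF density_carrier[OF \<rho>] density_carrier[OF \<rho>] U(1) U(1)])
  also have "\<dots> = (\<Sum>i<n. \<Sum>j<n. if i = j then r i powr \<alpha> * r i powr (1 - \<alpha>) else 0)"
    using overlap_self[OF U(2)] by (intro sum.cong) auto
  also have "\<dots> = (\<Sum>i<n. r i)"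
    using U(3) by (simp add: powr_add[symmetric])
  finally show ?thesis using U(4) by simp
qed

lemma petz_midpoint:
  assumes \<rho>: "density n \<rho>" and \<sigma>: "density n \<sigma>" and \<alpha>: "0 < \<alpha>" "\<alpha> \<noteq> 1"
  shows "0 < petz \<alpha> \<rho> (midpoint_mat \<rho> \<sigma>)"
    and "\<alpha> < 1 \<Longrightarrow> petz \<alpha> \<rho> (midpoint_mat \<rho> \<sigma>) \<le> 1"
    and "1 < \<alpha> \<Longrightarrow> 1 \<le> petz \<alpha> \<rho> (midpoint_mat \<rho> \<sigma>)"
    and "petz \<alpha> \<rho> (midpoint_mat \<rho> \<sigma>) = 1 \<longleftrightarrow> \<rho> = \<sigma>"
proof -
  obtain U V r t where U: "unitary_mat n U" and V: "unitary_mat n V"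
    and \<rho>_eq: "\<rho> = U * real_diag n r * mat_adjoint U" and M_eq: "midpoint_mat \<rho> \<sigma> = V * real_diag n t * mat_adjoint V"
    and "overlapping_distributions n (overlap U V) r t"
    and petz: "\<And>\<alpha>. petz \<alpha> \<rho> (midpoint_mat \<rho> \<sigma>) = overlapping_distributions.Q n (overlap U V) r t \<alpha>"
    using overlapping_midpoint[OF \<rho> \<sigma>] by blast
  interpret overlapping_distributions n "overlap U V" r t by fact
  show "0 < petz \<alpha> \<rho> (midpoint_mat \<rho> \<sigma>)" unfolding petz by (rule Q_pos)
  show "\<alpha> < 1 \<Longrightarrow> petz \<alpha> \<rho> (midpoint_mat \<rho> \<sigma>) \<le> 1" unfolding petz by (rule Q_le_1) (use \<alpha> in auto)
  show "1 < \<alpha> \<Longrightarrow> 1 \<le> petz \<alpha> \<rho> (midpoint_mat \<rho> \<sigma>)" unfolding petz by (rule Q_ge_1)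
  note c = density_carrier[OF \<rho>] density_carrier[OF \<sigma>]
  have mid_eq: "midpoint_mat \<rho> \<sigma> = \<rho> \<longleftrightarrow> \<rho> = \<sigma>"
  proof
    assume e: "midpoint_mat \<rho> \<sigma> = \<rho>"
    show "\<rho> = \<sigma>"
    proof (rule eq_matI)
      fix i j assume "i < dim_row \<sigma>" "j < dim_col \<sigma>"
      then have "\<rho> $$ (i, j) = (\<rho> $$ (i, j) + \<sigma> $$ (i, j)) / 2"
        using arg_cong[OF e, of "\<lambda>A. A $$ (i, j)"] c by simp
      then show "\<rho> $$ (i, j) = \<sigma> $$ (i, j)" by (simp add: field_simps)
    qed (use c in auto)
  qed (use c in \<open>auto intro!: eq_matI\<close>)
  show "petz \<alpha> \<rho> (midpoint_mat \<rho> \<sigma>) = 1 \<longleftrightarrow> \<rho> = \<sigma>"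
  proof
    assume "petz \<alpha> \<rho> (midpoint_mat \<rho> \<sigma>) = 1"
    \<comment> \<open>Equal eigenvalues at every nonzero overlap identify \<rho> with the midpoint,
      by \<open>spec_eq_iff\<close>.\<close>
    then have "r i = t j" if "i < n" "j < n" "overlap U V i j \<noteq> 0" for i j
      using that \<alpha> Q_le_1(2)[of \<alpha> i j] Q_ge_1(2)[of \<alpha> i j] unfolding petz by (cases "\<alpha> < 1") auto
    then have "V * real_diag n t * mat_adjoint V = U * real_diag n r * mat_adjoint U"
      unfolding spec_eq_iff[OF V U] by (simp add: overlap_def)
    then show "\<rho> = \<sigma>" using mid_eq \<rho>_eq M_eq by simp
  next
    assume "\<rho> = \<sigma>"
    then show "petz \<alpha> \<rho> (midpoint_mat \<rho> \<sigma>) = 1" using mid_eq petz_self[OF \<rho>] by metis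
  qed
qed

lemma D_ab_petz: "D_ab \<alpha> \<beta> \<rho> \<sigma> = (1 - petz \<alpha> \<rho> \<sigma> powr \<beta>) / ((1 - \<alpha>) * \<beta>)"
  by (simp add: D_ab_def petz_def)

lemma powr_eq_1_iff: "0 < x \<Longrightarrow> (b::real) \<noteq> 0 \<Longrightarrow> x powr b = 1 \<longleftrightarrow> x = (1::real)"
  by (auto simp: powr_def)

text \<open>Numerator and denominator change sign together: \<alpha> decides on which side of one
  \<open>q\<close> lies, and \<beta> whether \<open>powr\<close> preserves or reverses that
  order.\<close>

lemma power_entropy_nonneg:
  fixes q \<alpha> \<beta> :: real
  assumes q: "0 < q" and \<alpha>: "\<alpha> \<noteq> 1" "\<alpha> < 1 \<Longrightarrow> q \<le> 1" "1 < \<alpha> \<Longrightarrow> 1 \<le> q" and \<beta>: "\<beta> \<noteq> 0"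
  shows "0 \<le> (1 - q powr \<beta>) / ((1 - \<alpha>) * \<beta>)"
    and "(1 - q powr \<beta>) / ((1 - \<alpha>) * \<beta>) = 0 \<longleftrightarrow> q = 1"
proof -
  have pos: "q powr \<beta> \<le> 1" if "q \<le> 1" "0 < \<beta>" using powr_mono2[of \<beta> q 1] q that by simp
  have neg: "1 \<le> q powr \<beta>" if "q \<le> 1" "\<beta> < 0" using powr_mono2'[of \<beta> q 1] q that by simp
  have pos': "1 \<le> q powr \<beta>" if "1 \<le> q" "0 < \<beta>" using powr_mono2[of \<beta> 1 q] q that by simp
  have neg': "q powr \<beta> \<le> 1" if "1 \<le> q" "\<beta> < 0" using powr_mono2'[of \<beta> 1 q] q that by simp
  show "0 \<le> (1 - q powr \<beta>) / ((1 - \<alpha>) * \<beta>)"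
    using \<alpha> \<beta> pos neg pos' neg'
    by (cases rule: linorder_cases[of \<alpha> 1]; cases rule: linorder_cases[of \<beta> 0]) (auto simp: zero_le_divide_iff zero_le_mult_iff mult_le_0_iff)
  show "(1 - q powr \<beta>) / ((1 - \<alpha>) * \<beta>) = 0 \<longleftrightarrow> q = 1"
    using \<alpha> \<beta> powr_eq_1_iff[OF q \<beta>] by auto
qed

lemma D_ab_midpoint:
  assumes "density n \<rho>" "density n \<sigma>" "0 < \<alpha>" "\<alpha> \<noteq> 1" "\<beta> \<noteq> 0"
  shows "0 \<le> D_ab \<alpha> \<beta> \<rho> (midpoint_mat \<rho> \<sigma>)" and "D_ab \<alpha> \<beta> \<rho> (midpoint_mat \<rho> \<sigma>) = 0 \<longleftrightarrow> \<rho> = \<sigma>"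
  unfolding D_ab_petz
  using power_entropy_nonneg[of "petz \<alpha> \<rho> (midpoint_mat \<rho> \<sigma>)" \<alpha> \<beta>] petz_midpoint[OF assms(1-4)] assms(4,5) by auto

lemma J'_ab_nonneg:
  assumes \<rho>: "density n \<rho>" and \<sigma>: "density n \<sigma>" and "0 < \<alpha>" "\<alpha> \<noteq> 1" "\<beta> \<noteq> 0"
  shows "0 \<le> J'_ab \<alpha> \<beta> \<rho> \<sigma>" and "J'_ab \<alpha> \<beta> \<rho> \<sigma> = 0 \<longleftrightarrow> \<rho> = \<sigma>"
  unfolding J'_ab_def
  using D_ab_midpoint[OF \<rho> \<sigma> assms(3-5)] D_ab_midpoint[OF \<sigma> \<rho> assms(3-5)] midpoint_comm[OF \<rho> \<sigma>]
  by auto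

lemma J'_ab_sym:
  assumes "density n \<rho>" "density n \<sigma>"
  shows "J'_ab \<alpha> \<beta> \<rho> \<sigma> = J'_ab \<alpha> \<beta> \<sigma> \<rho>"
  by (simp add: J'_ab_def midpoint_comm[OF assms])

text \<open>Both eigenbases are multiplied by \<open>W\<close>, which cancels in the overlaps; the
  eigenvalues stay the same.\<close>

lemma petz_unitary:
  assumes W: "unitary_mat n W" and \<rho>: "density n \<rho>" and \<sigma>: "density n \<sigma>"
  shows "petz \<alpha> (W * \<rho> * mat_adjoint W) (W * \<sigma> * mat_adjoint W) = petz \<alpha> \<rho> \<sigma>"
proof -
  note c = density_carrier[OF \<rho>] density_carrier[OF \<sigma>]
  obtain U r where U: "spec_decomp \<rho> U r" "unitary_mat n U" "\<rho> = U * real_diag n r * mat_adjoint U"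
    using density_spectral[OF \<rho>] by blast
  obtain V t where V: "spec_decomp \<sigma> V t" "unitary_mat n V" "\<sigma> = V * real_diag n t * mat_adjoint V"
    using density_spectral[OF \<sigma>] by blast
  have Wc: "W \<in> carrier_mat n n" "mat_adjoint W \<in> carrier_mat n n"
    "U \<in> carrier_mat n n" "mat_adjoint U \<in> carrier_mat n n" "V \<in> carrier_mat n n" using W U V by auto
  have c': "W * \<rho> * mat_adjoint W \<in> carrier_mat n n" "W * \<sigma> * mat_adjoint W \<in> carrier_mat n n" using c Wc by auto
  have s: "spec_decomp (W * \<rho> * mat_adjoint W) (W * U) r" "spec_decomp (W * \<sigma> * mat_adjoint W) (W * V) t"
    unfolding spec_decomp_iff[OF c'(1)] spec_decomp_iff[OF c'(2)]
    using spec_unitary_congruence[OF U(2) Wc(1) U(3)] spec_unitary_congruence[OF V(2) Wc(1) V(3)] W U V by auto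
  have "mat_adjoint (W * U) * (W * V) = mat_adjoint U * V"
    using Wc by (simp add: mat_adjoint_mult[of _ n n _ n] assoc_mult_mat[of _ n n _ n _ n] mult_carrier_mat[of _ n n _ n]
        unitary_cancel(2)[OF W, of V n])
  then show ?thesis
    unfolding petz_eq[OF c' s] petz_eq[OF c U(1) V(1)] by (simp add: overlap_def)
qed

lemma J'_ab_unitary:
  assumes W: "unitary_mat n W" and \<rho>: "density n \<rho>" and \<sigma>: "density n \<sigma>"
  shows "J'_ab \<alpha> \<beta> (W * \<rho> * mat_adjoint W) (W * \<sigma> * mat_adjoint W) = J'_ab \<alpha> \<beta> \<rho> \<sigma>"
proof -
  have Wc: "W \<in> carrier_mat n n" "mat_adjoint W \<in> carrier_mat n n" using W by auto
  have "midpoint_mat (W * \<rho> * mat_adjoint W) (W * \<sigma> * mat_adjoint W) = W * midpoint_mat \<rho> \<sigma> * mat_adjoint W"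
    using Wc density_carrier[OF \<rho>] density_carrier[OF \<sigma>]
    by (simp add: add_mult_distrib_mat[of _ n n _ _ n] mult_add_distrib_mat[of _ n n _ n] mult_smult_assoc_mat[of _ n n _ n]
        mult_smult_distrib[of _ n n _ n] mult_carrier_mat[of _ n n _ n] add_carrier_mat[of _ n n])
  then show ?thesis
    unfolding J'_ab_def D_ab_petz
    using petz_unitary[OF W \<rho> density_midpoint[OF \<rho> \<sigma>]] petz_unitary[OF W \<sigma> density_midpoint[OF \<rho> \<sigma>]] by simp
qed

subsection \<open>Tensor products\<close>

lemma kron_carrier [simp]:
  "A \<in> carrier_mat n n \<Longrightarrow> B \<in> carrier_mat m m \<Longrightarrow> kron A B \<in> carrier_mat (n * m) (n * m)"
  by (auto simp: kron_def)

lemma kron_index: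
  assumes "A \<in> carrier_mat n n" "B \<in> carrier_mat m m" "i < n * m" "j < n * m"
  shows "kron A B $$ (i, j) = A $$ (i div m, j div m) * B $$ (i mod m, j mod m)"
  using assms by (auto simp: kron_def)

lemma sum_div_mod:
  "(\<Sum>i<n*m. f (i div m) (i mod m)) = (\<Sum>a<n. \<Sum>b<(m::nat). f a b)"
proof (cases "m = 0")
  case False
  have "(\<Sum>i<n*m. f (i div m) (i mod m)) = (\<Sum>(a, b)\<in>{..<n}\<times>{..<m}. f a b)"
  proof (rule sum.reindex_bij_witness[of _ "\<lambda>(a, b). a * m + b" "\<lambda>i. (i div m, i mod m)"])
    fix x assume "x \<in> {..<n} \<times> {..<m}"
    then obtain a b where x: "x = (a, b)" "a < n" "b < m" by auto
    have "a * m + b < Suc a * m" using x by simp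
    also have "\<dots> \<le> n * m" using x by (intro mult_right_mono) auto
    finally show "(case x of (a, b) \<Rightarrow> a * m + b) \<in> {..<n * m}" using x by simp
  qed (use False in \<open>auto simp: less_mult_imp_div_less\<close>)
  then show ?thesis by (simp add: sum.cartesian_product)
qed simp

lemma kron_mult:
  assumes A: "A \<in> carrier_mat n n" "C \<in> carrier_mat n n" and B: "B \<in> carrier_mat m m" "D \<in> carrier_mat m m"
  shows "kron A B * kron C D = kron (A * C) (B * D)"
proof (rule eq_matI)
  fix i j assume "i < dim_row (kron (A * C) (B * D))" "j < dim_col (kron (A * C) (B * D))"
  then have ij: "i < n * m" "j < n * m" using assms by (auto simp: kron_def)
  then have m: "0 < m" by (cases m) auto
  have dm: "i div m < n" "j div m < n" "i mod m < m" "j mod m < m"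
    using ij m by (auto simp: less_mult_imp_div_less)
  have "(kron A B * kron C D) $$ (i, j) = (\<Sum>k<n*m. kron A B $$ (i, k) * kron C D $$ (k, j))"
    using assms ij by (intro mult_mat_index_sum) auto
  also have "\<dots> = (\<Sum>k<n*m. (A $$ (i div m, k div m) * C $$ (k div m, j div m)) * (B $$ (i mod m, k mod m) * D $$ (k mod m, j mod m)))"
    using assms ij by (intro sum.cong) (auto simp: kron_index)
  also have "\<dots> = (\<Sum>a<n. \<Sum>b<m. (A $$ (i div m, a) * C $$ (a, j div m)) * (B $$ (i mod m, b) * D $$ (b, j mod m)))"
    by (rule sum_div_mod)
  also have "\<dots> = (A * C) $$ (i div m, j div m) * (B * D) $$ (i mod m, j mod m)"
    unfolding mult_mat_index_sum[OF A dm(1,2)] mult_mat_index_sum[OF B dm(3,4)] by (rule sum_product[symmetric])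
  also have "\<dots> = kron (A * C) (B * D) $$ (i, j)"
    using assms ij by (intro kron_index[symmetric]) auto
  finally show "(kron A B * kron C D) $$ (i, j) = kron (A * C) (B * D) $$ (i, j)" .
qed (use assms in \<open>auto simp: kron_def\<close>)

lemma mod_less_of_mult: "i < n * (m::nat) \<Longrightarrow> i mod m < m"
  by (cases m) auto

lemma kron_adjoint:
  assumes "A \<in> carrier_mat n n" "B \<in> carrier_mat m m"
  shows "mat_adjoint (kron A B) = kron (mat_adjoint A) (mat_adjoint B)"
proof (rule eq_matI)
  fix i j assume "i < dim_row (kron (mat_adjoint A) (mat_adjoint B))" "j < dim_col (kron (mat_adjoint A) (mat_adjoint B))"
  then have ij: "i < n * m" "j < n * m" using assms by (auto simp: kron_def)
  then show "mat_adjoint (kron A B) $$ (i, j) = kron (mat_adjoint A) (mat_adjoint B) $$ (i, j)"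
    using assms carrier_matD[OF kron_carrier[OF assms]]
    by (auto simp: kron_index[of _ n _ m] less_mult_imp_div_less mod_less_of_mult)
qed (use assms in \<open>auto simp: kron_def\<close>)

lemma kron_real_diag:
  "kron (real_diag n r) (real_diag m s) = real_diag (n * m) (\<lambda>i. r (i div m) * s (i mod m))"
proof (rule eq_matI)
  fix i j assume "i < dim_row (real_diag (n * m) (\<lambda>i. r (i div m) * s (i mod m)))"
    "j < dim_col (real_diag (n * m) (\<lambda>i. r (i div m) * s (i mod m)))"
  then have ij: "i < n * m" "j < n * m" by auto
  moreover have "i = j" if "i div m = j div m" "i mod m = j mod m" using that by (metis div_mult_mod_eq)
  ultimately show "kron (real_diag n r) (real_diag m s) $$ (i, j) = real_diag (n * m) (\<lambda>i. r (i div m) * s (i mod m)) $$ (i, j)"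
    by (auto simp: kron_index[of _ n _ m] real_diag_index less_mult_imp_div_less mod_less_of_mult)
qed (auto simp: kron_def)

lemma kron_one: "kron (1\<^sub>m n) (1\<^sub>m m) = 1\<^sub>m (n * m)"
  using kron_real_diag[of n "\<lambda>_. 1" m "\<lambda>_. 1"] by (simp add: real_diag_def mat_diag_one)

lemma spec_decomp_kron:
  assumes "\<rho> \<in> carrier_mat n n" "\<tau> \<in> carrier_mat m m" "spec_decomp \<rho> U r" "spec_decomp \<tau> S s"
  shows "spec_decomp (kron \<rho> \<tau>) (kron U S) (\<lambda>i. r (i div m) * s (i mod m))"
proof -
  have U: "unitary_mat n U" "\<rho> = U * real_diag n r * mat_adjoint U"
    and S: "unitary_mat m S" "\<tau> = S * real_diag m s * mat_adjoint S"
    using assms by (auto simp: spec_decomp_iff)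
  have c: "U \<in> carrier_mat n n" "mat_adjoint U \<in> carrier_mat n n"
    "S \<in> carrier_mat m m" "mat_adjoint S \<in> carrier_mat m m" using U S by auto
  have "kron U S * mat_adjoint (kron U S) = 1\<^sub>m (n * m)"
    unfolding kron_adjoint[OF c(1,3)] kron_mult[OF c(1,2,3,4)]
    using U S by (simp add: unitary_mat_def kron_one)
  then have "unitary_mat (n * m) (kron U S)" using c by (intro unitary_matI) auto
  moreover have "kron \<rho> \<tau> = kron U S * real_diag (n * m) (\<lambda>i. r (i div m) * s (i mod m)) * mat_adjoint (kron U S)"
    using c unfolding U(2) S(2) kron_adjoint[OF c(1,3)] kron_real_diag[symmetric]
    by (simp add: kron_mult[of _ n _ _ m] mult_carrier_mat[of _ n n _ n] mult_carrier_mat[of _ m m _ m])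
  ultimately show ?thesis
    using spec_decomp_iff[OF kron_carrier[OF assms(1,2)]] by auto
qed

text \<open>Eigenvalues and overlaps of Kronecker products are products, and the sum over composite
  indices factors through quotient and remainder by \<open>m\<close>. In \<open>J'_ab_kron\<close>
  both second factors are \<tau>, and \<open>petz_self\<close> makes their contribution one.\<close>

lemma petz_kron:
  assumes \<rho>: "density n \<rho>" and \<sigma>: "density n \<sigma>" and \<tau>: "density m \<tau>" and \<upsilon>: "density m \<upsilon>"
  shows "petz \<alpha> (kron \<rho> \<tau>) (kron \<sigma> \<upsilon>) = petz \<alpha> \<rho> \<sigma> * petz \<alpha> \<tau> \<upsilon>"
proof -
  note c = density_carrier[OF \<rho>] density_carrier[OF \<sigma>] density_carrier[OF \<tau>] density_carrier[OF \<upsilon>]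
  obtain U r where U: "spec_decomp \<rho> U r" "unitary_mat n U" "\<And>i. 0 \<le> r i" using density_spectral[OF \<rho>] by blast
  obtain V t where V: "spec_decomp \<sigma> V t" "unitary_mat n V" "\<And>i. 0 \<le> t i" using density_spectral[OF \<sigma>] by blast
  obtain S s where S: "spec_decomp \<tau> S s" "unitary_mat m S" "\<And>i. 0 \<le> s i" using density_spectral[OF \<tau>] by blast
  obtain T u where T: "spec_decomp \<upsilon> T u" "unitary_mat m T" "\<And>i. 0 \<le> u i" using density_spectral[OF \<upsilon>] by blast
  have cc: "U \<in> carrier_mat n n" "V \<in> carrier_mat n n" "S \<in> carrier_mat m m" "T \<in> carrier_mat m m"
    using U V S T by auto
  have ov: "overlap (kron U S) (kron V T) i j = overlap U V (i div m) (j div m) * overlap S T (i mod m) (j mod m)"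
    if "i < n * m" "j < n * m" for i j
    using that cc
    by (simp add: overlap_def kron_adjoint[OF cc(1,3)] kron_mult[of _ n _ _ m] kron_index[of _ n _ m]
        mult_carrier_mat[of _ n n _ n] mult_carrier_mat[of _ m m _ m] norm_mult power_mult_distrib del: index_mult_mat(1))
  define f where "f a c = overlap U V a c * (r a powr \<alpha> * t c powr (1 - \<alpha>))" for a c
  define g where "g b d = overlap S T b d * (s b powr \<alpha> * u d powr (1 - \<alpha>))" for b d
  have "petz \<alpha> (kron \<rho> \<tau>) (kron \<sigma> \<upsilon>) = (\<Sum>i<n*m. \<Sum>j<n*m. f (i div m) (j div m) * g (i mod m) (j mod m))"
    unfolding petz_eq[OF kron_carrier[OF c(1,3)] kron_carrier[OF c(2,4)] spec_decomp_kron[OF c(1,3) U(1) S(1)] spec_decomp_kron[OF c(2,4) V(1) T(1)]]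
    using U(3) V(3) S(3) T(3) by (intro sum.cong refl) (simp add: ov f_def g_def powr_mult)
  also have "\<dots> = (\<Sum>i<n*m. (\<Sum>c<n. f (i div m) c) * (\<Sum>d<m. g (i mod m) d))"
    by (intro sum.cong refl) (simp add: sum_div_mod[of "\<lambda>c d. f _ c * g _ d"] sum_product)
  also have "\<dots> = (\<Sum>a<n. \<Sum>b<m. (\<Sum>c<n. f a c) * (\<Sum>d<m. g b d))"
    by (rule sum_div_mod[of "\<lambda>a b. (\<Sum>c<n. f a c) * (\<Sum>d<m. g b d)"])
  also have "\<dots> = (\<Sum>a<n. \<Sum>c<n. f a c) * (\<Sum>b<m. \<Sum>d<m. g b d)" by (rule sum_product[symmetric])
  also have "\<dots> = petz \<alpha> \<rho> \<sigma> * petz \<alpha> \<tau> \<upsilon>"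
    unfolding petz_eq[OF c(1,2) U(1) V(1)] petz_eq[OF c(3,4) S(1) T(1)] f_def g_def by simp
  finally show ?thesis .
qed

lemma J'_ab_kron:
  assumes \<rho>: "density n \<rho>" and \<sigma>: "density n \<sigma>" and \<tau>: "density m \<tau>"
  shows "J'_ab \<alpha> \<beta> (kron \<rho> \<tau>) (kron \<sigma> \<tau>) = J'_ab \<alpha> \<beta> \<rho> \<sigma>"
proof -
  note c = density_carrier[OF \<rho>] density_carrier[OF \<sigma>] density_carrier[OF \<tau>]
  have "midpoint_mat (kron \<rho> \<tau>) (kron \<sigma> \<tau>) = kron (midpoint_mat \<rho> \<sigma>) \<tau>"
    using c by (intro eq_matI) (auto simp: kron_def less_mult_imp_div_less algebra_simps)
  then show ?thesis
    unfolding J'_ab_def D_ab_petz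
    using petz_kron[OF \<rho> density_midpoint[OF \<rho> \<sigma>] \<tau> \<tau>] petz_kron[OF \<sigma> density_midpoint[OF \<rho> \<sigma>] \<tau> \<tau>] petz_self[OF \<tau>]
    by simp
qed

subsection \<open>A variational formula for fractional powers\<close>

text \<open>The integrand is at most \<open>s powr (\<alpha> - 1)\<close> up to 1 and at most
  \<open>s powr (\<alpha> - 2)\<close> beyond; the range of \<alpha> puts these exponents above and
  below -1 respectively.\<close>

lemma integrable_powr_div:
  fixes \<alpha> :: real
  assumes \<alpha>: "0 < \<alpha>" "\<alpha> < 1"
  shows "integrable lborel (\<lambda>s. indicator {0<..} s * (s powr (\<alpha> - 1) / (1 + s)))"
proof -
  \<comment> \<open>Bridge from the gauge integral: for nonnegative functions it yields absolute
    integrability over \<open>lebesgue\<close>, and Borel measurability brings this down to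
    \<open>lborel\<close>.\<close>
  have pos_integrable: "integrable lborel (\<lambda>s. indicator A s *\<^sub>R f s)"
    if "f integrable_on A" "\<And>s. s \<in> A \<Longrightarrow> 0 \<le> f s" "f \<in> borel_measurable borel" "A \<in> sets borel"
    for A :: "real set" and f :: "real \<Rightarrow> real"
  proof -
    have "integrable lebesgue (\<lambda>s. indicator A s *\<^sub>R f s)"
      using nonnegative_absolutely_integrable_1[OF that(1,2)] by (simp add: set_integrable_def)
    then show ?thesis using that(3,4) by (subst (asm) integrable_completion) auto
  qed
  have "integrable lborel (\<lambda>s. indicator {0..1} s *\<^sub>R s powr (\<alpha> - 1))"
    using has_integral_powr_from_0[of "\<alpha> - 1" 1] \<alpha> by (intro pos_integrable) (auto intro: has_integral_integrable)
  moreover have "integrable lborel (\<lambda>s. indicator {1..} s *\<^sub>R s powr (\<alpha> - 2))"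
    using has_integral_powr_to_inf[of "\<alpha> - 2" 1] \<alpha> by (intro pos_integrable) (auto intro: has_integral_integrable)
  ultimately have "integrable lborel (\<lambda>s. indicator {0..1} s *\<^sub>R s powr (\<alpha> - 1) + indicator {1..} s *\<^sub>R s powr (\<alpha> - 2))"
    by (rule Bochner_Integration.integrable_add)
  then show ?thesis
  proof (rule Bochner_Integration.integrable_bound)
    have "norm (indicator {0<..} s * (s powr (\<alpha> - 1) / (1 + s)))
        \<le> norm (indicator {0..1} s *\<^sub>R s powr (\<alpha> - 1) + indicator {1..} s *\<^sub>R s powr (\<alpha> - 2))" for s :: real
    proof -
      consider "s \<le> 0" | "0 < s" "s \<le> 1" | "1 < s" by linarith
      then show ?thesis
      proof cases
        case 2
        have "s powr (\<alpha> - 1) / (1 + s) \<le> s powr (\<alpha> - 1) / 1"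
          using 2 by (intro divide_left_mono) auto
        also have "\<dots> \<le> s powr (\<alpha> - 1) + indicator {1..} s *\<^sub>R s powr (\<alpha> - 2)" by simp
        finally show ?thesis using 2 by (simp add: indicator_def)
      next
        case 3
        have "s powr (\<alpha> - 1) / (1 + s) \<le> s powr (\<alpha> - 1) / s"
          using 3 by (intro divide_left_mono) auto
        also have "\<dots> = s powr (\<alpha> - 2)" using 3 powr_diff[of s "\<alpha> - 1" 1] by simp
        finally show ?thesis using 3 by (simp add: indicator_def)
      qed (simp add: indicator_def)
    qed
    then show "AE s in lborel. norm (indicator {0<..} s * (s powr (\<alpha> - 1) / (1 + s)))
        \<le> norm (indicator {0..1} s *\<^sub>R s powr (\<alpha> - 1) + indicator {1..} s *\<^sub>R s powr (\<alpha> - 2))" by simp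
  qed measurable
qed

text \<open>Scaling the variable by \<open>k = t / r\<close> turns \<open>1 + s\<close> into
  \<open>(r + s * t) / r\<close>, so all pairs \<open>r\<close>, \<open>t\<close> reduce to one
  integral. Its value \<open>c\<close> is common to all of them, so the identity passes to weighted
  sums over eigenvalues.\<close>

lemma powr_mult_integral:
  fixes \<alpha> :: real
  assumes \<alpha>: "0 < \<alpha>" "\<alpha> < 1"
  obtains c where "0 < c" and "\<And>r t. 0 \<le> r \<Longrightarrow> 0 \<le> t \<Longrightarrow>
    has_bochner_integral lborel (\<lambda>s. indicator {0<..} s * (s powr (\<alpha> - 1) * (r * t / (r + s * t))))
      (c * (r powr \<alpha> * t powr (1 - \<alpha>)))"
proof -
  define f :: "real \<Rightarrow> real" where "f s = indicator {0<..} s * (s powr (\<alpha> - 1) / (1 + s))" for s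
  have int: "integrable lborel f" unfolding f_def by (rule integrable_powr_div[OF \<alpha>])
  define c where "c = integral\<^sup>L lborel f"
  have c: "has_bochner_integral lborel f c" using int by (simp add: has_bochner_integral_iff c_def)
  \<comment> \<open>A lower bound of \<open>f\<close> between 1 and 2: the decreasing power is at
    least its value at 2, and \<open>1 + s\<close> is at most 3. It forces \<open>c\<close> to be
    positive.\<close>
  define K :: real where "K = 2 powr (\<alpha> - 1) / 3"
  have "indicator {1..2} s * K \<le> f s" for s
  proof (cases "s \<in> {1..2}")
    case True
    then have "2 powr (\<alpha> - 1) \<le> s powr (\<alpha> - 1)" using \<alpha> by (intro powr_mono2') auto
    then have "K \<le> s powr (\<alpha> - 1) / (1 + s)" unfolding K_def using True by (intro frac_le) auto
    then show ?thesis using True by (simp add: f_def)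
  qed (auto simp: f_def indicator_def)
  moreover have "has_bochner_integral lborel (\<lambda>s. indicator {1..2::real} s * K) (1 * K)"
    by (intro has_bochner_integral_mult_left) (simp add: has_bochner_integral_iff)
  ultimately have "1 * K \<le> c"
    using int integral_mono[of lborel "\<lambda>s. indicator {1..2} s * K" f] unfolding c_def has_bochner_integral_iff by simp
  moreover have "0 < K" by (simp add: K_def)
  ultimately have "0 < c" by simp
  moreover have "has_bochner_integral lborel (\<lambda>s. indicator {0<..} s * (s powr (\<alpha> - 1) * (r * t / (r + s * t))))
      (c * (r powr \<alpha> * t powr (1 - \<alpha>)))" if "0 \<le> r" "0 \<le> t" for r t
  proof (cases "r = 0 \<or> t = 0")
    case True
    then show ?thesis using \<alpha> by (auto simp: has_bochner_integral_zero)
  next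
    case False
    then have rt: "0 < r" "0 < t" using that by auto
    define k where "k = t / r"
    have k: "0 < k" using rt by (simp add: k_def)
    have "has_bochner_integral lborel (\<lambda>s. f (0 + k * s)) (c /\<^sub>R \<bar>k\<bar>)"
      using lborel_has_bochner_integral_real_affine_iff[of k f c 0] c k by auto
    then have "has_bochner_integral lborel (\<lambda>s. (t * k powr (1 - \<alpha>)) * f (0 + k * s)) (t * k powr (1 - \<alpha>) * (c /\<^sub>R \<bar>k\<bar>))"
      by (intro has_bochner_integral_mult_right)
    moreover have "(t * k powr (1 - \<alpha>)) * f (0 + k * s) = indicator {0<..} s * (s powr (\<alpha> - 1) * (r * t / (r + s * t)))" for s
    proof (cases "0 < s")
      case True
      have "k powr (1 - \<alpha>) * (k * s) powr (\<alpha> - 1) = s powr (\<alpha> - 1)"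
        using True k by (simp add: powr_mult powr_add[symmetric] mult.assoc[symmetric])
      moreover have "t / (1 + k * s) = r * t / (r + s * t)"
        using rt True by (simp add: k_def field_simps)
      ultimately have "(k powr (1 - \<alpha>) * (k * s) powr (\<alpha> - 1)) * (t / (1 + k * s)) = s powr (\<alpha> - 1) * (r * t / (r + s * t))"
        by simp
      moreover have "0 < k * s" using True k by simp
      ultimately show ?thesis using True by (simp add: f_def mult_ac)
    next
      case False
      then have "\<not> 0 < k * s" using k by (simp add: zero_less_mult_iff)
      then show ?thesis using False by (simp add: f_def)
    qed
    moreover have "t * k powr (1 - \<alpha>) * (c /\<^sub>R \<bar>k\<bar>) = c * (r powr \<alpha> * t powr (1 - \<alpha>))"
    proof -
      have "t / k = r" using rt by (simp add: k_def)
      moreover have "r * k powr (1 - \<alpha>) = r powr \<alpha> * t powr (1 - \<alpha>)"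
      proof -
        have "r * k powr (1 - \<alpha>) = r powr 1 / r powr (1 - \<alpha>) * t powr (1 - \<alpha>)"
          using rt by (simp add: k_def powr_divide)
        also have "r powr 1 / r powr (1 - \<alpha>) = r powr \<alpha>" unfolding powr_diff[symmetric] by simp
        finally show ?thesis .
      qed
      ultimately show ?thesis using k by (simp add: divide_inverse mult_ac) (metis mult.assoc mult.commute)
    qed
    ultimately show ?thesis by (simp only:)
  qed
  ultimately show ?thesis using that by blast
qed

section \<open>A quadratic form whose minimum is a parallel sum\<close>

definition sandwich_trace :: "complex mat \<Rightarrow> complex mat \<Rightarrow> real" where
  "sandwich_trace \<rho> X = Re (mtrace (\<rho> * (X * mat_adjoint X)))"

text \<open>The cost of splitting the identity into \<open>X\<close> and
  \<open>1\<^sub>m n - X\<close>. For positive semidefinite \<rho> and \<sigma> the two traces are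
  squared Frobenius norms: of the square root of \<rho> times \<open>X\<close>, and of
  \<open>1\<^sub>m n - X\<close> times the square root of \<sigma>.\<close>

definition split_form :: "nat \<Rightarrow> real \<Rightarrow> complex mat \<Rightarrow> complex mat \<Rightarrow> complex mat \<Rightarrow> real" where
  "split_form n s \<rho> \<sigma> X = sandwich_trace \<rho> X + s * sandwich_trace \<sigma> (mat_adjoint (1\<^sub>m n - X))"

lemma sandwich_trace_spec:
  assumes U: "unitary_mat n U" and V: "unitary_mat n V" and Z: "Z \<in> carrier_mat n n"
    and \<rho>: "\<rho> = U * real_diag n r * mat_adjoint U"
  shows "sandwich_trace \<rho> (U * Z * mat_adjoint V) = (\<Sum>i<n. \<Sum>j<n. r i * (cmod (Z $$ (i, j)))\<^sup>2)"
proof -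
  note mc = assoc_mult_mat[of _ n n _ n _ n] mult_carrier_mat[of _ n n _ n]
  have c: "U \<in> carrier_mat n n" "V \<in> carrier_mat n n"
     "mat_adjoint U \<in> carrier_mat n n" "mat_adjoint V \<in> carrier_mat n n" "mat_adjoint Z \<in> carrier_mat n n" using U V Z by auto
  have "mat_adjoint (U * Z * mat_adjoint V) = V * mat_adjoint Z * mat_adjoint U"
    using c Z by (simp add: mc mat_adjoint_mult[of _ n n _ n])
  then have "\<rho> * ((U * Z * mat_adjoint V) * mat_adjoint (U * Z * mat_adjoint V))
      = U * (real_diag n r * (Z * mat_adjoint Z) * mat_adjoint U)"
    using c Z by (simp add: \<rho> mc unitary_cancel(2)[OF U, of _ n] unitary_cancel(2)[OF V, of _ n])
  then have "mtrace (\<rho> * ((U * Z * mat_adjoint V) * mat_adjoint (U * Z * mat_adjoint V)))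
      = mtrace (real_diag n r * (Z * mat_adjoint Z) * mat_adjoint U * U)"
    using c Z by (simp add: mtrace_comm[of U n n] mc)
  also have "real_diag n r * (Z * mat_adjoint Z) * mat_adjoint U * U = real_diag n r * (Z * mat_adjoint Z)"
    using c Z U by (simp add: mc) (simp add: unitary_mat_def)
  also have "mtrace \<dots> = (\<Sum>i<n. r i * (\<Sum>j<n. Z $$ (i, j) * cnj (Z $$ (i, j))))"
    using c Z by (subst mtrace_real_diag_mult) (auto simp: mult_adjoint_index[OF Z Z] simp del: index_mult_mat(1))
  also have "\<dots> = complex_of_real (\<Sum>i<n. \<Sum>j<n. r i * (cmod (Z $$ (i, j)))\<^sup>2)"
    by (simp only: of_real_sum of_real_mult complex_norm_square sum_distrib_left)
  finally show ?thesis by (simp only: sandwich_trace_def Re_complex_of_real)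
qed

text \<open>The identity is \<open>U * (mat_adjoint U * V) * mat_adjoint V\<close>, so in these
  coordinates \<open>1\<^sub>m n - X\<close> has the matrix \<open>mat_adjoint U * V - Z\<close>.
  Each entry of \<open>Z\<close> then occurs in one summand only.\<close>

lemma split_form_spec:
  assumes U: "unitary_mat n U" and V: "unitary_mat n V" and Z: "Z \<in> carrier_mat n n"
    and \<rho>: "\<rho> = U * real_diag n r * mat_adjoint U" and \<sigma>: "\<sigma> = V * real_diag n t * mat_adjoint V"
  shows "split_form n s \<rho> \<sigma> (U * Z * mat_adjoint V)
    = (\<Sum>i<n. \<Sum>j<n. r i * (cmod (Z $$ (i, j)))\<^sup>2 + s * t j * (cmod ((mat_adjoint U * V) $$ (i, j) - Z $$ (i, j)))\<^sup>2)"
proof -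
  note mc = assoc_mult_mat[of _ n n _ n _ n] mult_carrier_mat[of _ n n _ n]
  have c: "U \<in> carrier_mat n n" "V \<in> carrier_mat n n"
     "mat_adjoint U \<in> carrier_mat n n" "mat_adjoint V \<in> carrier_mat n n" using U V by auto
  define Y where "Y = mat_adjoint U * V - Z"
  have Yc: "Y \<in> carrier_mat n n" "mat_adjoint Y \<in> carrier_mat n n" using c Z by (auto simp: Y_def)
  have Ye: "cmod (mat_adjoint Y $$ (j, i)) = cmod ((mat_adjoint U * V) $$ (i, j) - Z $$ (i, j))" if "i < n" "j < n" for i j
  proof -
    have "Y $$ (i, j) = (mat_adjoint U * V) $$ (i, j) - Z $$ (i, j)"
      unfolding Y_def using Z that by (intro index_minus_mat) auto
    moreover have "mat_adjoint Y $$ (j, i) = cnj (Y $$ (i, j))"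
      using Yc that by (intro mat_adjoint_index) auto
    ultimately show ?thesis by (metis complex_mod_cnj)
  qed
  have "U * Y * mat_adjoint V = U * (mat_adjoint U * V) * mat_adjoint V - U * Z * mat_adjoint V"
    using c Z by (simp add: Y_def mult_minus_distrib_mat[of _ n n _ n] minus_mult_distrib_mat[of _ n n _ _ n] mc)
  also have "U * (mat_adjoint U * V) * mat_adjoint V = 1\<^sub>m n"
    using c U V by (simp add: unitary_cancel(1)[OF U, of _ n]) (simp add: unitary_mat_def)
  finally have "mat_adjoint (1\<^sub>m n - U * Z * mat_adjoint V) = mat_adjoint (U * Y * mat_adjoint V)" by simp
  also have "\<dots> = V * mat_adjoint Y * mat_adjoint U"
    using c Yc by (simp add: mc mat_adjoint_mult[of _ n n _ n])
  finally have "split_form n s \<rho> \<sigma> (U * Z * mat_adjoint V)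
    = (\<Sum>i<n. \<Sum>j<n. r i * (cmod (Z $$ (i, j)))\<^sup>2) + s * (\<Sum>j<n. \<Sum>i<n. t j * (cmod (mat_adjoint Y $$ (j, i)))\<^sup>2)"
    unfolding split_form_def sandwich_trace_spec[OF U V Z \<rho>] using sandwich_trace_spec[OF V U Yc(2) \<sigma>] by simp
  also have "(\<Sum>j<n. \<Sum>i<n. t j * (cmod (mat_adjoint Y $$ (j, i)))\<^sup>2)
      = (\<Sum>i<n. \<Sum>j<n. t j * (cmod ((mat_adjoint U * V) $$ (i, j) - Z $$ (i, j)))\<^sup>2)"
    by (subst sum.swap) (simp add: Ye)
  finally show ?thesis by (simp only: sum_distrib_left sum.distrib mult.assoc)
qed

text \<open>The triangle inequality reduces this to the real numbers \<open>a = cmod z\<close> and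
  \<open>b = cmod (w - z)\<close>; after clearing the denominator the remaining gap is the square
  \<open>(r * a - k * b)\<^sup>2\<close>.\<close>

lemma parallel_sum_le:
  fixes r k :: real and z w :: complex
  assumes r: "0 \<le> r" and k: "0 \<le> k"
  shows "(cmod w)\<^sup>2 * (r * k / (r + k)) \<le> r * (cmod z)\<^sup>2 + k * (cmod (w - z))\<^sup>2"
proof (cases "r + k = 0")
  case False
  define a b where "a = cmod z" "b = cmod (w - z)"
  have "cmod w \<le> a + b" using norm_triangle_ineq[of z "w - z"] by (simp add: a_b_def)
  then have "(cmod w)\<^sup>2 \<le> (a + b)\<^sup>2" by (intro power_mono) auto
  then have "(cmod w)\<^sup>2 * (r * k / (r + k)) \<le> (a + b)\<^sup>2 * (r * k / (r + k))"
    using r k by (intro mult_right_mono) auto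
  also have "\<dots> \<le> r * a\<^sup>2 + k * b\<^sup>2"
  proof -
    have "(r * a\<^sup>2 + k * b\<^sup>2) * (r + k) - (a + b)\<^sup>2 * (r * k) = (r * a - k * b)\<^sup>2"
      by (simp add: power2_eq_square algebra_simps)
    then have "(a + b)\<^sup>2 * (r * k) \<le> (r * a\<^sup>2 + k * b\<^sup>2) * (r + k)"
      by (metis diff_ge_0_iff_ge zero_le_power2)
    then show ?thesis using r k False by (simp add: divide_le_eq)
  qed
  finally show ?thesis by (simp add: a_b_def)
qed (use r k in auto)

text \<open>The minimiser balances the two terms: \<open>r * z = k * (w - z)\<close>.\<close>

lemma parallel_sum_attained:
  fixes r k :: real and w :: complex
  assumes "0 \<le> r" "0 \<le> k"
  defines "z \<equiv> w * complex_of_real (k / (r + k))"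
  shows "r * (cmod z)\<^sup>2 + k * (cmod (w - z))\<^sup>2 = (cmod w)\<^sup>2 * (r * k / (r + k))"
proof (cases "r + k = 0")
  case True
  then show ?thesis using assms by auto
next
  case False
  have "w - z = w * complex_of_real (1 - k / (r + k))" by (simp add: z_def algebra_simps)
  also have "1 - k / (r + k) = r / (r + k)" using False by (simp add: field_simps)
  finally have wz: "w - z = w * complex_of_real (r / (r + k))" .
  have "r * (cmod z)\<^sup>2 + k * (cmod (w - z))\<^sup>2 = (cmod w)\<^sup>2 * (r * (k / (r + k))\<^sup>2 + k * (r / (r + k))\<^sup>2)"
    unfolding wz unfolding z_def norm_mult norm_of_real power_mult_distrib power2_abs by (simp add: algebra_simps)
  also have "r * (k / (r + k))\<^sup>2 + k * (r / (r + k))\<^sup>2 = (r * k * (r + k)) / (r + k)\<^sup>2"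
    by (simp add: power_divide add_divide_distrib[symmetric] power2_eq_square algebra_simps)
  also have "\<dots> = r * k / (r + k)" using False by (simp add: power2_eq_square)
  finally show ?thesis .
qed

text \<open>A minimum over all matrices, free of eigenbases, can be compared between different
  states and dimensions. Division by \<open>s\<close> turns the scalar minimum
  \<open>r * (s * t) / (r + s * t)\<close> into the fraction that occurs in
  \<open>powr_mult_integral\<close>.\<close>

definition parallel_sum :: "nat \<Rightarrow> complex mat \<Rightarrow> complex mat \<Rightarrow> real \<Rightarrow> real" where
  "parallel_sum n \<rho> \<sigma> s = (INF X\<in>carrier_mat n n. split_form n s \<rho> \<sigma> X) / s"

lemma parallel_sum_spec:
  assumes U: "unitary_mat n U" and V: "unitary_mat n V"
    and \<rho>: "\<rho> = U * real_diag n r * mat_adjoint U" and \<sigma>: "\<sigma> = V * real_diag n t * mat_adjoint V"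
    and r: "\<And>i. 0 \<le> r i" and t: "\<And>i. 0 \<le> t i" and s: "0 < s"
  shows "parallel_sum n \<rho> \<sigma> s = (\<Sum>i<n. \<Sum>j<n. overlap U V i j * (r i * t j / (r i + s * t j)))"
    and "\<And>X. X \<in> carrier_mat n n \<Longrightarrow> s * parallel_sum n \<rho> \<sigma> s \<le> split_form n s \<rho> \<sigma> X"
    and "\<exists>X\<in>carrier_mat n n. split_form n s \<rho> \<sigma> X = s * parallel_sum n \<rho> \<sigma> s"
proof -
  note mc = assoc_mult_mat[of _ n n _ n _ n] mult_carrier_mat[of _ n n _ n]
  have c: "U \<in> carrier_mat n n" "V \<in> carrier_mat n n"
     "mat_adjoint U \<in> carrier_mat n n" "mat_adjoint V \<in> carrier_mat n n" using U V by auto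
  define W where "W = mat_adjoint U * V"
  define P where "P = (\<Sum>i<n. \<Sum>j<n. overlap U V i j * (r i * t j / (r i + s * t j)))"
  have st: "0 \<le> s * t j" for j using s t by simp
  have sP: "s * P = (\<Sum>i<n. \<Sum>j<n. (cmod (W $$ (i, j)))\<^sup>2 * (r i * (s * t j) / (r i + s * t j)))"
    unfolding P_def sum_distrib_left overlap_def W_def[symmetric] by (simp add: mult_ac)
  have lower: "s * P \<le> split_form n s \<rho> \<sigma> X" if X: "X \<in> carrier_mat n n" for X
  proof -
    define Z where "Z = mat_adjoint U * X * V"
    have Z: "Z \<in> carrier_mat n n" using c X by (auto simp: Z_def)
    have "X = U * Z * mat_adjoint V"
    proof -
      have "U * Z * mat_adjoint V = U * (mat_adjoint U * (X * (V * mat_adjoint V)))"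
        using c X by (simp add: Z_def mc)
      also have "\<dots> = X" using V X by (simp add: unitary_mat_def unitary_cancel(1)[OF U, of _ n])
      finally show ?thesis by simp
    qed
    then have "split_form n s \<rho> \<sigma> X = (\<Sum>i<n. \<Sum>j<n. r i * (cmod (Z $$ (i, j)))\<^sup>2 + s * t j * (cmod (W $$ (i, j) - Z $$ (i, j)))\<^sup>2)"
      using split_form_spec[OF U V Z \<rho> \<sigma>] by (simp only: W_def)
    then show ?thesis unfolding sP by (simp only:) (intro sum_mono parallel_sum_le r st)
  qed
  have attained: "\<exists>X\<in>carrier_mat n n. split_form n s \<rho> \<sigma> X = s * P"
  proof -
    \<comment> \<open>The scalar minimisers of \<open>parallel_sum_attained\<close> for
      \<open>k = s * t j\<close>, filled in entry by entry.\<close>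
    define Z where "Z = mat n n (\<lambda>(i, j). W $$ (i, j) * complex_of_real (s * t j / (r i + s * t j)))"
    have Z: "Z \<in> carrier_mat n n" by (simp add: Z_def)
    have "split_form n s \<rho> \<sigma> (U * Z * mat_adjoint V) = s * P"
      unfolding split_form_spec[OF U V Z \<rho> \<sigma>] sP
    proof (intro sum.cong refl)
      fix i j assume "i \<in> {..<n}" "j \<in> {..<n}"
      then have "Z $$ (i, j) = W $$ (i, j) * complex_of_real (s * t j / (r i + s * t j))" by (simp add: Z_def)
      then show "r i * (cmod (Z $$ (i, j)))\<^sup>2 + s * t j * (cmod ((mat_adjoint U * V) $$ (i, j) - Z $$ (i, j)))\<^sup>2
         = (cmod (W $$ (i, j)))\<^sup>2 * (r i * (s * t j) / (r i + s * t j))"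
        using parallel_sum_attained[OF r st, of i "W $$ (i, j)" j] by (simp only: W_def)
    qed
    moreover have "U * Z * mat_adjoint V \<in> carrier_mat n n" using c Z by auto
    ultimately show ?thesis by blast
  qed
  have "(INF X\<in>carrier_mat n n. split_form n s \<rho> \<sigma> X) = s * P"
    using attained lower by (intro cInf_eq_minimum) (force simp: image_iff)+
  then have "parallel_sum n \<rho> \<sigma> s = P" using s by (simp add: parallel_sum_def)
  then show "parallel_sum n \<rho> \<sigma> s = (\<Sum>i<n. \<Sum>j<n. overlap U V i j * (r i * t j / (r i + s * t j)))"
    "\<And>X. X \<in> carrier_mat n n \<Longrightarrow> s * parallel_sum n \<rho> \<sigma> s \<le> split_form n s \<rho> \<sigma> X"
    "\<exists>X\<in>carrier_mat n n. split_form n s \<rho> \<sigma> X = s * parallel_sum n \<rho> \<sigma> s"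
    using lower attained by (simp_all add: P_def)
qed

lemma density_parallel_sum:
  assumes \<rho>: "density n \<rho>" and \<sigma>: "density n \<sigma>" and s: "0 < s"
  shows "X \<in> carrier_mat n n \<Longrightarrow> s * parallel_sum n \<rho> \<sigma> s \<le> split_form n s \<rho> \<sigma> X"
    and "\<exists>X\<in>carrier_mat n n. split_form n s \<rho> \<sigma> X = s * parallel_sum n \<rho> \<sigma> s"
  using density_spectral[OF \<rho>] density_spectral[OF \<sigma>] parallel_sum_spec(2,3)[OF _ _ _ _ _ _ s] by metis+

text \<open>The constant is fixed before dimension and states are chosen, so the traces of the input
  and the output of a channel are integrals with the same normalisation.\<close>

lemma petz_integral:
  fixes \<alpha> :: real
  assumes \<alpha>: "0 < \<alpha>" "\<alpha> < 1"
  obtains c where "0 < c" and "\<And>n \<rho> \<sigma>. density n \<rho> \<Longrightarrow> density n \<sigma> \<Longrightarrow>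
    has_bochner_integral lborel (\<lambda>s. indicator {0<..} s * (s powr (\<alpha> - 1) * parallel_sum n \<rho> \<sigma> s)) (c * petz \<alpha> \<rho> \<sigma>)"
proof -
  obtain c where c: "0 < c" and int: "\<And>r t. 0 \<le> r \<Longrightarrow> 0 \<le> t \<Longrightarrow>
    has_bochner_integral lborel (\<lambda>s. indicator {0<..} s * (s powr (\<alpha> - 1) * (r * t / (r + s * t))))
      (c * (r powr \<alpha> * t powr (1 - \<alpha>)))" using powr_mult_integral[OF \<alpha>] by blast
  have "has_bochner_integral lborel (\<lambda>s. indicator {0<..} s * (s powr (\<alpha> - 1) * parallel_sum n \<rho> \<sigma> s)) (c * petz \<alpha> \<rho> \<sigma>)"
    if \<rho>: "density n \<rho>" and \<sigma>: "density n \<sigma>" for n \<rho> \<sigma>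
  proof -
    obtain U r where U: "spec_decomp \<rho> U r" "unitary_mat n U" "\<rho> = U * real_diag n r * mat_adjoint U"
      "\<And>i. 0 \<le> r i" using density_spectral[OF \<rho>] by blast
    obtain V t where V: "spec_decomp \<sigma> V t" "unitary_mat n V" "\<sigma> = V * real_diag n t * mat_adjoint V"
      "\<And>i. 0 \<le> t i" using density_spectral[OF \<sigma>] by blast
    have "has_bochner_integral lborel
        (\<lambda>s. \<Sum>i<n. \<Sum>j<n. overlap U V i j * (indicator {0<..} s * (s powr (\<alpha> - 1) * (r i * t j / (r i + s * t j)))))
        (\<Sum>i<n. \<Sum>j<n. overlap U V i j * (c * (r i powr \<alpha> * t j powr (1 - \<alpha>))))"
      by (intro has_bochner_integral_sum has_bochner_integral_mult_right int U V)
    moreover have "(\<Sum>i<n. \<Sum>j<n. overlap U V i j * (indicator {0<..} s * (s powr (\<alpha> - 1) * (r i * t j / (r i + s * t j)))))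
        = indicator {0<..} s * (s powr (\<alpha> - 1) * parallel_sum n \<rho> \<sigma> s)" for s
    proof (cases "0 < s")
      case True
      then show ?thesis
        unfolding parallel_sum_spec(1)[OF U(2) V(2) U(3) V(3) U(4) V(4) True] sum_distrib_left by (simp add: mult_ac)
    qed simp
    moreover have "(\<Sum>i<n. \<Sum>j<n. overlap U V i j * (c * (r i powr \<alpha> * t j powr (1 - \<alpha>)))) = c * petz \<alpha> \<rho> \<sigma>"
      unfolding petz_eq[OF density_carrier[OF \<rho>] density_carrier[OF \<sigma>] U(1) V(1)] sum_distrib_left by (simp add: mult_ac)
    ultimately show ?thesis by simp
  qed
  with c that show ?thesis by blast
qed

text \<open>Comparing the variational forms for every weight \<open>s\<close> compares the traces, since the
  latter are integrals of the former against a positive kernel.\<close>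
lemma petz_comparison:
  fixes p :: "'j \<Rightarrow> real"
  assumes \<alpha>: "0 < \<alpha>" "\<alpha> < 1" and J: "finite J" and p: "\<And>j. j \<in> J \<Longrightarrow> 0 \<le> p j"
    and \<rho>: "\<And>j. j \<in> J \<Longrightarrow> density n (\<rho> j)" and \<sigma>: "\<And>j. j \<in> J \<Longrightarrow> density n (\<sigma> j)"
    and \<rho>': "density m \<rho>'" and \<sigma>': "density m \<sigma>'"
    and le: "\<And>s Y. 0 < s \<Longrightarrow> Y \<in> carrier_mat m m \<Longrightarrow>
      \<exists>X\<in>carrier_mat n n. (\<Sum>j\<in>J. p j * split_form n s (\<rho> j) (\<sigma> j) X) \<le> split_form m s \<rho>' \<sigma>' Y"
  shows "(\<Sum>j\<in>J. p j * petz \<alpha> (\<rho> j) (\<sigma> j)) \<le> petz \<alpha> \<rho>' \<sigma>'"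
proof -
  obtain c where c: "0 < c" and int: "\<And>n \<rho> \<sigma>. density n \<rho> \<Longrightarrow> density n \<sigma> \<Longrightarrow>
    has_bochner_integral lborel (\<lambda>s. indicator {0<..} s * (s powr (\<alpha> - 1) * parallel_sum n \<rho> \<sigma> s)) (c * petz \<alpha> \<rho> \<sigma>)"
    using petz_integral[OF \<alpha>] by blast
  have pointwise: "(\<Sum>j\<in>J. p j * parallel_sum n (\<rho> j) (\<sigma> j) s) \<le> parallel_sum m \<rho>' \<sigma>' s" if s: "0 < s" for s
  proof -
    \<comment> \<open>\<open>Y\<close> is optimal for the right-hand side; on the left any trial
      matrix bounds each minimum from above, and one \<open>X\<close> may serve all
      \<open>j\<close>.\<close>
    obtain Y where Y: "Y \<in> carrier_mat m m" "split_form m s \<rho>' \<sigma>' Y = s * parallel_sum m \<rho>' \<sigma>' s"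
      using density_parallel_sum(2)[OF \<rho>' \<sigma>' s] by blast
    obtain X where X: "X \<in> carrier_mat n n" "(\<Sum>j\<in>J. p j * split_form n s (\<rho> j) (\<sigma> j) X) \<le> split_form m s \<rho>' \<sigma>' Y"
      using le[OF s Y(1)] by blast
    have "s * (\<Sum>j\<in>J. p j * parallel_sum n (\<rho> j) (\<sigma> j) s) = (\<Sum>j\<in>J. p j * (s * parallel_sum n (\<rho> j) (\<sigma> j) s))"
      by (simp add: sum_distrib_left mult_ac)
    also have "\<dots> \<le> (\<Sum>j\<in>J. p j * split_form n s (\<rho> j) (\<sigma> j) X)"
      using density_parallel_sum(1)[OF \<rho> \<sigma> s X(1)] p by (intro sum_mono mult_left_mono) auto
    also have "\<dots> \<le> s * parallel_sum m \<rho>' \<sigma>' s" using X(2) Y(2) by simp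
    finally show ?thesis using s by simp
  qed
  have "has_bochner_integral lborel
      (\<lambda>s. \<Sum>j\<in>J. p j * (indicator {0<..} s * (s powr (\<alpha> - 1) * parallel_sum n (\<rho> j) (\<sigma> j) s)))
      (\<Sum>j\<in>J. p j * (c * petz \<alpha> (\<rho> j) (\<sigma> j)))" (is "has_bochner_integral _ ?f ?x")
    by (intro has_bochner_integral_sum has_bochner_integral_mult_right int \<rho> \<sigma>)
  moreover have "?f s \<le> indicator {0<..} s * (s powr (\<alpha> - 1) * parallel_sum m \<rho>' \<sigma>' s)" for s
  proof (cases "0 < s")
    case True
    then have "?f s = s powr (\<alpha> - 1) * (\<Sum>j\<in>J. p j * parallel_sum n (\<rho> j) (\<sigma> j) s)"
      by (simp add: sum_distrib_left mult_ac)
    then show ?thesis using pointwise[OF True] True by (simp add: mult_left_mono)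
  qed simp
  ultimately have "?x \<le> c * petz \<alpha> \<rho>' \<sigma>'"
    using int[OF \<rho>' \<sigma>'] unfolding has_bochner_integral_iff by (metis (no_types, lifting) integral_mono)
  moreover have "?x = c * (\<Sum>j\<in>J. p j * petz \<alpha> (\<rho> j) (\<sigma> j))" by (simp add: sum_distrib_left mult_ac)
  ultimately show ?thesis using c by simp
qed

subsection \<open>Monotonicity under quantum operations\<close>

lemma mtrace_adjoint: "A \<in> carrier_mat n n \<Longrightarrow> mtrace (mat_adjoint A) = cnj (mtrace A)"
  by (auto simp: mtrace_def)

lemma mtrace_minus: "A \<in> carrier_mat n n \<Longrightarrow> B \<in> carrier_mat n n \<Longrightarrow> mtrace (A - B) = mtrace A - mtrace B"
  by (auto simp: mtrace_def sum_subtractf)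

text \<open>Values on the matrix units \<open>e (a, b)\<close> determine \<phi>; the induction
  switches on one entry of \<open>Z\<close> at a time.\<close>

lemma linear_functional_mtrace:
  fixes \<phi> :: "complex mat \<Rightarrow> complex"
  assumes add: "\<And>A B. A \<in> carrier_mat n n \<Longrightarrow> B \<in> carrier_mat n n \<Longrightarrow> \<phi> (A + B) = \<phi> A + \<phi> B"
    and smult: "\<And>A c. A \<in> carrier_mat n n \<Longrightarrow> \<phi> (c \<cdot>\<^sub>m A) = c * \<phi> A"
  shows "\<exists>X\<in>carrier_mat n n. \<forall>Z\<in>carrier_mat n n. \<phi> Z = mtrace (Z * X)"
proof -
  define e where "e p = mat n n (\<lambda>q. if q = p then 1 else (0::complex))" for p
  \<comment> \<open>The indices are transposed because \<open>mtrace (Z * X)\<close> pairs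
    \<open>Z $$ (a, b)\<close> with \<open>X $$ (b, a)\<close>.\<close>
  define X where "X = mat n n (\<lambda>(b, a). \<phi> (e (a, b)))"
  have ec: "e p \<in> carrier_mat n n" for p by (simp add: e_def)
  have "\<phi> Z = mtrace (Z * X)" if Z: "Z \<in> carrier_mat n n" for Z
  proof -
    have "\<phi> (mat n n (\<lambda>q. if q \<in> S then Z $$ q else 0)) = (\<Sum>q\<in>S. Z $$ q * \<phi> (e q))"
      if "finite S" for S
      using that
    proof (induction S)
      case empty
      have "mat n n (\<lambda>q. 0) = 0 \<cdot>\<^sub>m (0\<^sub>m n n :: complex mat)" by (rule eq_matI) auto
      then show ?case using smult[of "0\<^sub>m n n" 0] by simp
    next
      case (insert q S)
      have "mat n n (\<lambda>x. if x \<in> insert q S then Z $$ x else 0)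
          = Z $$ q \<cdot>\<^sub>m e q + mat n n (\<lambda>x. if x \<in> S then Z $$ x else 0)"
        using insert.hyps by (intro eq_matI) (auto simp: e_def)
      then show ?case using insert ec by (simp add: add smult)
    qed
    from this[of "{..<n} \<times> {..<n}"]
    have "\<phi> (mat n n (\<lambda>q. if q \<in> {..<n} \<times> {..<n} then Z $$ q else 0)) = (\<Sum>a<n. \<Sum>b<n. Z $$ (a, b) * \<phi> (e (a, b)))"
      by (simp add: sum.cartesian_product case_prod_beta)
    also have "mat n n (\<lambda>q. if q \<in> {..<n} \<times> {..<n} then Z $$ q else 0) = Z"
      using Z by (intro eq_matI) auto
    also have "(\<Sum>a<n. \<Sum>b<n. Z $$ (a, b) * \<phi> (e (a, b))) = mtrace (Z * X)"
      using Z by (subst mtrace_mult_eq[of _ n n]) (auto simp: X_def)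
    finally show ?thesis .
  qed
  then show ?thesis by (intro bexI[of _ X]) (auto simp: X_def)
qed

text \<open>The block column of the identity and \<open>mat_adjoint X\<close>, times \<rho>, times
  the adjoint of that column is positive semidefinite; the amplification with \<open>k = 2\<close>
  applies \<open>E\<close> to each of its four blocks.\<close>

lemma cptp_block:
  assumes E: "cptp n m E" and \<rho>: "psd n \<rho>" and X: "X \<in> carrier_mat n n"
  obtains R where "psd (2 * m) R"
    "\<And>i j. i < m \<Longrightarrow> j < m \<Longrightarrow> R $$ (i, j) = E \<rho> $$ (i, j)"
    "\<And>i j. i < m \<Longrightarrow> j < m \<Longrightarrow> R $$ (i, m + j) = E (\<rho> * X) $$ (i, j)"
    "\<And>i j. i < m \<Longrightarrow> j < m \<Longrightarrow> R $$ (m + i, j) = E (mat_adjoint X * \<rho>) $$ (i, j)"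
    "\<And>i j. i < m \<Longrightarrow> j < m \<Longrightarrow> R $$ (m + i, m + j) = E (mat_adjoint X * \<rho> * X) $$ (i, j)"
proof -
  note mc = assoc_mult_mat[of _ n n _ n _ n] mult_carrier_mat[of _ n n _ n]
  have \<rho>c: "\<rho> \<in> carrier_mat n n" using \<rho> by (rule psd_carrier)
  obtain U l where Ul: "spec_decomp \<rho> U l" and l: "\<And>i. 0 \<le> l i" using psd_spectral[OF \<rho>] by blast
  have U: "U \<in> carrier_mat n n" and \<rho>_eq: "\<rho> = U * real_diag n l * mat_adjoint U"
    using Ul by (auto simp: spec_decomp_iff[OF \<rho>c])
  define G where "G = mat_adjoint X * U"
  have G: "G \<in> carrier_mat n n" using U X by (auto simp: G_def)
  have Ga: "mat_adjoint G = mat_adjoint U * X" using U X by (simp add: G_def mat_adjoint_mult[of _ n n _ n])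
  \<comment> \<open>\<open>g k\<close> is eigenvector \<open>k\<close> of \<rho> stacked on its
    image under \<open>mat_adjoint X\<close>.\<close>
  define g where "g k i = (if i < n then U $$ (i, k) else G $$ (i - n, k))" for k i
  define P where "P = mat (2*n) (2*n) (\<lambda>(i, j). \<Sum>k<n. l k * (g k i * cnj (g k j)))"
  have P: "psd (2*n) P"
    by (rule psd_gramI[of _ _ "{..<n}" l g]) (auto simp: P_def l)
  have Uac: "mat_adjoint U \<in> carrier_mat n n" "mat_adjoint X \<in> carrier_mat n n" using U X by auto
  have e: "\<rho> * X = U * real_diag n l * mat_adjoint G" "mat_adjoint X * \<rho> = G * real_diag n l * mat_adjoint U"
    "mat_adjoint X * \<rho> * X = G * real_diag n l * mat_adjoint G"
    using U X Uac unfolding Ga \<rho>_eq by (simp_all add: mc G_def)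
  have lt2: "a < 2 * n" "n + a < 2 * n" if "a < n" for a using that by auto
  have b00: "mat n n (\<lambda>(r, s). P $$ (0 * n + r, 0 * n + s)) = \<rho>"
    using U by (subst \<rho>_eq, intro eq_matI)
      (auto simp: P_def g_def lt2 mult_diag_adjoint_index[OF U U] simp del: index_mult_mat(1))
  have b01: "mat n n (\<lambda>(r, s). P $$ (0 * n + r, 1 * n + s)) = \<rho> * X"
    unfolding e(1) using U G by (intro eq_matI)
      (auto simp: P_def g_def lt2 mult_diag_adjoint_index[OF U G] simp del: index_mult_mat(1))
  have b10: "mat n n (\<lambda>(r, s). P $$ (1 * n + r, 0 * n + s)) = mat_adjoint X * \<rho>"
    unfolding e(2) using U G by (intro eq_matI)
      (auto simp: P_def g_def lt2 mult_diag_adjoint_index[OF G U] simp del: index_mult_mat(1))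
  have b11: "mat n n (\<lambda>(r, s). P $$ (1 * n + r, 1 * n + s)) = mat_adjoint X * \<rho> * X"
    unfolding e(3) using U G by (intro eq_matI)
      (auto simp: P_def g_def lt2 mult_diag_adjoint_index[OF G G] simp del: index_mult_mat(1))
  have "psd (2 * m) (ampl 2 n m E P)" using E P unfolding cptp_def by blast
  then show ?thesis
  proof (rule that)
    fix i j assume ij: "i < m" "j < m"
    have dm: "i div m = 0" "j div m = 0" "(m + i) div m = 1" "(m + j) div m = 1" "i mod m = i" "j mod m = j"
      "(m + i) mod m = i" "(m + j) mod m = j" using ij by auto
    have bd: "i < 2 * m" "j < 2 * m" "m + i < 2 * m" "m + j < 2 * m" using ij by auto
    show "ampl 2 n m E P $$ (i, j) = E \<rho> $$ (i, j)"
      using bd by (simp only: ampl_def index_mat prod.case dm b00)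
    show "ampl 2 n m E P $$ (i, m + j) = E (\<rho> * X) $$ (i, j)"
      using bd by (simp only: ampl_def index_mat prod.case dm b01)
    show "ampl 2 n m E P $$ (m + i, j) = E (mat_adjoint X * \<rho>) $$ (i, j)"
      using bd by (simp only: ampl_def index_mat prod.case dm b10)
    show "ampl 2 n m E P $$ (m + i, m + j) = E (mat_adjoint X * \<rho> * X) $$ (i, j)"
      using bd by (simp only: ampl_def index_mat prod.case dm b11)
  qed
qed

lemma sum_lessThan_double: "(\<Sum>i<2*m. f i) = (\<Sum>i<m. f i) + (\<Sum>i<m. f (m + i))" for f :: "nat \<Rightarrow> 'a::comm_monoid_add"
proof -
  have "(\<Sum>i<2*m. f i) = (\<Sum>i=0..<m. f i) + (\<Sum>i=m..<m+m. f i)"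
    by (subst sum.atLeastLessThan_concat) (auto simp: atLeast0LessThan mult_2)
  also have "(\<Sum>i=m..<m+m. f i) = (\<Sum>i<m. f (m + i))"
    using sum.shift_bounds_nat_ivl[of f 0 m m] by (simp add: atLeast0LessThan add.commute)
  finally show ?thesis by (simp add: atLeast0LessThan)
qed

text \<open>The trace expression is the sum over \<open>c\<close> of the quadratic forms of
  \<open>R\<close> at the columns of the block column \<open>Y\<close>, -1.\<close>

lemma psd_block_trace:
  assumes R: "psd (2 * m) R"
    and c: "A \<in> carrier_mat m m" "B \<in> carrier_mat m m" "C \<in> carrier_mat m m" "D \<in> carrier_mat m m"
    and RA: "\<And>i j. i < m \<Longrightarrow> j < m \<Longrightarrow> R $$ (i, j) = A $$ (i, j)"
    and RB: "\<And>i j. i < m \<Longrightarrow> j < m \<Longrightarrow> R $$ (i, m + j) = B $$ (i, j)"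
    and RC: "\<And>i j. i < m \<Longrightarrow> j < m \<Longrightarrow> R $$ (m + i, j) = C $$ (i, j)"
    and RD: "\<And>i j. i < m \<Longrightarrow> j < m \<Longrightarrow> R $$ (m + i, m + j) = D $$ (i, j)"
    and Y: "Y \<in> carrier_mat m m"
  shows "0 \<le> Re (mtrace (A * (Y * mat_adjoint Y)) - mtrace (B * mat_adjoint Y) - mtrace (C * Y) + mtrace D)"
proof -
  have Ya: "mat_adjoint Y \<in> carrier_mat m m" using Y by auto
  have q: "0 \<le> Re ((\<Sum>i<m. \<Sum>j<m. cnj (Y $$ (i, c)) * A $$ (i, j) * Y $$ (j, c))
      - (\<Sum>i<m. cnj (Y $$ (i, c)) * B $$ (i, c)) - (\<Sum>j<m. C $$ (c, j) * Y $$ (j, c)) + D $$ (c, c))" if c: "c < m" for c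
  proof -
    \<comment> \<open>Column \<open>c\<close> of that block column: column \<open>c\<close> of
      \<open>Y\<close> above minus the unit vector \<open>c\<close>.\<close>
    define f where "f i = (if i < m then Y $$ (i, c) else if i = m + c then - 1 else 0)" for i
    have "0 \<le> Re (\<Sum>i<2*m. \<Sum>j<2*m. cnj (f i) * R $$ (i, j) * f j)" by (rule psd_quadratic(2)[OF R])
    also have "(\<Sum>i<2*m. \<Sum>j<2*m. cnj (f i) * R $$ (i, j) * f j)
       = (\<Sum>i<m. (\<Sum>j<m. cnj (Y $$ (i, c)) * A $$ (i, j) * Y $$ (j, c)) + (\<Sum>j<m. if j = c then - (cnj (Y $$ (i, c)) * B $$ (i, j)) else 0))
       + (\<Sum>i<m. (\<Sum>j<m. if i = c then - (C $$ (i, j) * Y $$ (j, c)) else 0) + (\<Sum>j<m. if i = c then if j = c then D $$ (i, j) else 0 else 0))"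
      unfolding sum_lessThan_double
      by (intro arg_cong2[where f = "(+)"] sum.cong refl) (auto simp: f_def RA RB RC RD)
    also have "\<dots> = (\<Sum>i<m. \<Sum>j<m. cnj (Y $$ (i, c)) * A $$ (i, j) * Y $$ (j, c))
      - (\<Sum>i<m. cnj (Y $$ (i, c)) * B $$ (i, c)) - (\<Sum>j<m. C $$ (c, j) * Y $$ (j, c)) + D $$ (c, c)"
    proof -
      have "(\<Sum>j<m. if i = c then - (C $$ (i, j) * Y $$ (j, c)) else 0) = (if i = c then - (\<Sum>j<m. C $$ (c, j) * Y $$ (j, c)) else 0)" for i
        by (simp add: sum_negf)
      moreover have "(\<Sum>j<m. if i = c then if j = c then D $$ (i, j) else 0 else 0) = (if i = c then D $$ (c, c) else 0)" for i
        using c by simp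
      ultimately show ?thesis using c by (simp add: sum.distrib sum_negf sum_subtractf)
    qed
    finally show ?thesis .
  qed
  have "mtrace (A * (Y * mat_adjoint Y)) = mtrace (mat_adjoint Y * (A * Y))"
    using c Y Ya by (subst assoc_mult_mat[of A m m Y m _ m, symmetric]) (auto intro!: mtrace_comm[of _ m m])
  also have "\<dots> = (\<Sum>c<m. \<Sum>i<m. \<Sum>j<m. cnj (Y $$ (i, c)) * A $$ (i, j) * Y $$ (j, c))"
  proof -
    have "mtrace (mat_adjoint Y * (A * Y)) = (\<Sum>c<m. \<Sum>i<m. mat_adjoint Y $$ (c, i) * (A * Y) $$ (i, c))"
      using c Y Ya by (intro mtrace_mult_eq) auto
    also have "\<dots> = (\<Sum>c<m. \<Sum>i<m. cnj (Y $$ (i, c)) * (\<Sum>j<m. A $$ (i, j) * Y $$ (j, c)))"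
      using Y by (intro sum.cong refl) (auto simp: mult_mat_index_sum[OF c(1) Y] simp del: index_mult_mat(1))
    finally show ?thesis by (simp only: sum_distrib_left mult.assoc)
  qed
  finally have tA: "mtrace (A * (Y * mat_adjoint Y)) = (\<Sum>c<m. \<Sum>i<m. \<Sum>j<m. cnj (Y $$ (i, c)) * A $$ (i, j) * Y $$ (j, c))" .
  have "mtrace (B * mat_adjoint Y) = mtrace (mat_adjoint Y * B)" using c Ya by (intro mtrace_comm) auto
  also have "\<dots> = (\<Sum>c<m. \<Sum>i<m. cnj (Y $$ (i, c)) * B $$ (i, c))"
    using Y by (subst mtrace_mult_eq[OF Ya c(2)]) auto
  finally have tB: "mtrace (B * mat_adjoint Y) = (\<Sum>c<m. \<Sum>i<m. cnj (Y $$ (i, c)) * B $$ (i, c))" .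
  have tD: "mtrace D = (\<Sum>c<m. D $$ (c, c))" using c by (simp add: mtrace_def)
  have "mtrace (A * (Y * mat_adjoint Y)) - mtrace (B * mat_adjoint Y) - mtrace (C * Y) + mtrace D
     = (\<Sum>c<m. (\<Sum>i<m. \<Sum>j<m. cnj (Y $$ (i, c)) * A $$ (i, j) * Y $$ (j, c))
      - (\<Sum>i<m. cnj (Y $$ (i, c)) * B $$ (i, c)) - (\<Sum>j<m. C $$ (c, j) * Y $$ (j, c)) + D $$ (c, c))"
    unfolding tA tB tD mtrace_mult_eq[OF c(3) Y] by (simp only: sum.distrib sum_subtractf)
  then show ?thesis using q by (simp only: Re_sum) (intro sum_nonneg, auto)
qed

section \<open>The dual map of a quantum operation\<close>

context
  fixes n m :: nat and E :: "complex mat \<Rightarrow> complex mat"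
  assumes E: "cptp n m E"
begin

lemma cptp_carrier: "X \<in> carrier_mat n n \<Longrightarrow> E X \<in> carrier_mat m m"
  and cptp_add: "X \<in> carrier_mat n n \<Longrightarrow> Y \<in> carrier_mat n n \<Longrightarrow> E (X + Y) = E X + E Y"
  and cptp_smult: "X \<in> carrier_mat n n \<Longrightarrow> E (c \<cdot>\<^sub>m X) = c \<cdot>\<^sub>m E X"
  and cptp_mtrace: "X \<in> carrier_mat n n \<Longrightarrow> mtrace (E X) = mtrace X"
  using E by (simp_all add: cptp_def)

lemma cptp_density:
  assumes \<rho>: "density n \<rho>"
  shows "density m (E \<rho>)"
proof -
  have c: "\<rho> \<in> carrier_mat n n" using \<rho> by (rule density_carrier)
  \<comment> \<open>Positivity of \<open>E\<close> is the case \<open>k = 1\<close> of complete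
    positivity.\<close>
  have "psd (1 * m) (ampl 1 n m E \<rho>)"
    using E \<rho> unfolding cptp_def density_def by (metis mult_1)
  moreover have "ampl 1 n m E \<rho> = E \<rho>"
  proof -
    have "mat n n (\<lambda>(r, s). \<rho> $$ (r, s)) = \<rho>" using c by (intro eq_matI) auto
    then show ?thesis using cptp_carrier[OF c] by (intro eq_matI) (auto simp: ampl_def)
  qed
  ultimately show ?thesis using \<rho> cptp_mtrace[OF c] by (simp add: density_def)
qed

text \<open>In the block matrix built from the identity and \<open>Z\<close>, the images of
  \<open>Z\<close> and of its adjoint occupy opposite corners, and a positive semidefinite matrix is
  Hermitian.\<close>

lemma cptp_adjoint:
  assumes Z: "Z \<in> carrier_mat n n"
  shows "E (mat_adjoint Z) = mat_adjoint (E Z)"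
proof -
  have one: "psd n (1\<^sub>m n)"
    by (rule psd_gramI[where K = "{..<n}" and l = "\<lambda>_. 1" and g = "\<lambda>k i. if i = k then 1 else 0"])
      (auto simp: if_distrib[of cnj] if_distrib[of "\<lambda>x. x * _"] cong: if_cong)
  obtain R where R: "psd (2 * m) R"
    "\<And>i j. i < m \<Longrightarrow> j < m \<Longrightarrow> R $$ (i, m + j) = E (1\<^sub>m n * Z) $$ (i, j)"
    "\<And>i j. i < m \<Longrightarrow> j < m \<Longrightarrow> R $$ (m + i, j) = E (mat_adjoint Z * 1\<^sub>m n) $$ (i, j)"
    using cptp_block[OF E one Z] by metis
  have id: "1\<^sub>m n * Z = Z" "mat_adjoint Z * 1\<^sub>m n = mat_adjoint Z" using Z by auto
  have c: "E Z \<in> carrier_mat m m" "E (mat_adjoint Z) \<in> carrier_mat m m" using Z by (auto intro!: cptp_carrier)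
  show ?thesis
  proof (rule eq_matI)
    fix i j assume "i < dim_row (mat_adjoint (E Z))" "j < dim_col (mat_adjoint (E Z))"
    then have ij: "i < m" "j < m" using c by auto
    have "E (mat_adjoint Z) $$ (i, j) = R $$ (m + i, j)" using R(3)[OF ij] id by simp
    also have "\<dots> = cnj (R $$ (j, m + i))" using ij by (intro psd_hermitian_index[OF R(1)]) auto
    also have "\<dots> = mat_adjoint (E Z) $$ (i, j)" using R(2)[OF ij(2,1)] id ij c by simp
    finally show "E (mat_adjoint Z) $$ (i, j) = mat_adjoint (E Z) $$ (i, j)" .
  qed (use c in auto)
qed

text \<open>\<open>X\<close> is the image of \<open>Y\<close> in the Heisenberg picture, expressed
  by the trace pairing; as a relation it needs no choice of representative.\<close>

definition is_dual :: "complex mat \<Rightarrow> complex mat \<Rightarrow> bool" where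
  "is_dual Y X \<longleftrightarrow> Y \<in> carrier_mat m m \<and> X \<in> carrier_mat n n \<and> (\<forall>Z\<in>carrier_mat n n. mtrace (E Z * Y) = mtrace (Z * X))"

lemma dual_exists:
  assumes Y: "Y \<in> carrier_mat m m"
  shows "\<exists>X. is_dual Y X"
proof -
  have "\<exists>X\<in>carrier_mat n n. \<forall>Z\<in>carrier_mat n n. mtrace (E Z * Y) = mtrace (Z * X)"
  proof (rule linear_functional_mtrace)
    fix A B :: "complex mat" assume "A \<in> carrier_mat n n" "B \<in> carrier_mat n n"
    then show "mtrace (E (A + B) * Y) = mtrace (E A * Y) + mtrace (E B * Y)"
      using Y cptp_carrier by (simp add: cptp_add add_mult_distrib_mat[of _ m m _ _ m] mtrace_add[of _ m] mult_carrier_mat[of _ m m _ m])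
  next
    fix A :: "complex mat" and c assume "A \<in> carrier_mat n n"
    then show "mtrace (E (c \<cdot>\<^sub>m A) * Y) = c * mtrace (E A * Y)"
      using Y cptp_carrier by (simp add: cptp_smult mult_smult_assoc_mat[of _ m m _ m] mtrace_smult[of _ m] mult_carrier_mat[of _ m m _ m])
  qed
  then show ?thesis using Y by (auto simp: is_dual_def)
qed

text \<open>\<open>E\<close> commutes with adjoints, so conjugating the pairing and using cyclicity
  of the trace transfers the relation.\<close>

lemma dual_adjoint:
  assumes "is_dual Y X"
  shows "is_dual (mat_adjoint Y) (mat_adjoint X)"
proof -
  have c: "Y \<in> carrier_mat m m" "X \<in> carrier_mat n n" using assms by (auto simp: is_dual_def)
  have "mtrace (E Z * mat_adjoint Y) = mtrace (Z * mat_adjoint X)" if Z: "Z \<in> carrier_mat n n" for Z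
  proof -
    have Zc: "E Z \<in> carrier_mat m m" "mat_adjoint Z \<in> carrier_mat n n" "mat_adjoint (E Z) \<in> carrier_mat m m"
      using Z cptp_carrier[OF Z] by auto
    have "mtrace (E Z * mat_adjoint Y) = mtrace (mat_adjoint (Y * E (mat_adjoint Z)))"
      using c Zc by (simp add: cptp_adjoint[OF Z] mat_adjoint_mult[of _ m m _ m])
    also have "\<dots> = cnj (mtrace (E (mat_adjoint Z) * Y))"
      using c Zc cptp_carrier by (subst mtrace_adjoint[of _ m]) (auto simp: mtrace_comm[of Y m m])
    also have "\<dots> = cnj (mtrace (mat_adjoint Z * X))" using assms Zc by (simp add: is_dual_def)
    also have "\<dots> = mtrace (mat_adjoint X * Z)"
      using c Z Zc by (subst mtrace_adjoint[of _ n, symmetric]) (auto simp: mat_adjoint_mult[of _ n n _ n])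
    also have "\<dots> = mtrace (Z * mat_adjoint X)" using c Z by (intro mtrace_comm[of _ n n]) auto
    finally show ?thesis .
  qed
  then show ?thesis using c by (auto simp: is_dual_def)
qed

text \<open>Trace preservation says that the dual map sends the identity to the identity.\<close>

lemma dual_one_minus:
  assumes "is_dual Y X"
  shows "is_dual (1\<^sub>m m - Y) (1\<^sub>m n - X)"
proof -
  have c: "Y \<in> carrier_mat m m" "X \<in> carrier_mat n n" using assms by (auto simp: is_dual_def)
  have "mtrace (E Z * (1\<^sub>m m - Y)) = mtrace (Z * (1\<^sub>m n - X))" if Z: "Z \<in> carrier_mat n n" for Z
    using assms c Z cptp_carrier[OF Z]
    by (simp add: mult_minus_distrib_mat[of _ m m _ m] mult_minus_distrib_mat[of _ n n _ n] mtrace_minus[of _ m] mtrace_minus[of _ n]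
        mult_carrier_mat[of _ m m _ m] mult_carrier_mat[of _ n n _ n] cptp_mtrace is_dual_def)
  then show ?thesis using c by (auto simp: is_dual_def)
qed

text \<open>The Kadison--Schwarz inequality for the dual map, tested against \<open>\<rho>\<close>: the 2-positivity
  block with columns \<open>\<rho>, \<rho>X\<close> is paired with the block column \<open>Y, -1\<close>.\<close>
lemma sandwich_trace_dual:
  assumes \<rho>: "psd n \<rho>" and dual: "is_dual Y X"
  shows "sandwich_trace \<rho> X \<le> sandwich_trace (E \<rho>) Y"
proof -
  note mc = assoc_mult_mat[of _ n n _ n _ n] mult_carrier_mat[of _ n n _ n]
  have c: "Y \<in> carrier_mat m m" "X \<in> carrier_mat n n" "mat_adjoint X \<in> carrier_mat n n" "\<rho> \<in> carrier_mat n n"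
    using dual \<rho> by (auto simp: is_dual_def psd_carrier)
  have c': "\<rho> * X \<in> carrier_mat n n" "mat_adjoint X * \<rho> \<in> carrier_mat n n" "mat_adjoint X * \<rho> * X \<in> carrier_mat n n"
    using c by auto
  obtain R where R: "psd (2 * m) R"
    "\<And>i j. i < m \<Longrightarrow> j < m \<Longrightarrow> R $$ (i, j) = E \<rho> $$ (i, j)"
    "\<And>i j. i < m \<Longrightarrow> j < m \<Longrightarrow> R $$ (i, m + j) = E (\<rho> * X) $$ (i, j)"
    "\<And>i j. i < m \<Longrightarrow> j < m \<Longrightarrow> R $$ (m + i, j) = E (mat_adjoint X * \<rho>) $$ (i, j)"
    "\<And>i j. i < m \<Longrightarrow> j < m \<Longrightarrow> R $$ (m + i, m + j) = E (mat_adjoint X * \<rho> * X) $$ (i, j)"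
    by (rule cptp_block[OF E \<rho> c(2)]) blast
  have "0 \<le> Re (mtrace (E \<rho> * (Y * mat_adjoint Y)) - mtrace (E (\<rho> * X) * mat_adjoint Y)
      - mtrace (E (mat_adjoint X * \<rho>) * Y) + mtrace (E (mat_adjoint X * \<rho> * X)))"
    using c c' by (intro psd_block_trace[OF R(1) _ _ _ _ R(2-5)]) (auto intro: cptp_carrier)
  \<comment> \<open>By duality and trace preservation the last three traces all equal
    \<open>mtrace (\<rho> * (X * mat_adjoint X))\<close>; with signs -1, -1, +1 one copy is left to
    subtract.\<close>
  moreover have "mtrace (E (\<rho> * X) * mat_adjoint Y) = mtrace (\<rho> * (X * mat_adjoint X))"
    using dual_adjoint[OF dual] c c' by (simp add: is_dual_def mc)
  moreover have "mtrace (mat_adjoint X * \<rho> * X) = mtrace (\<rho> * (X * mat_adjoint X))"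
    using c by (simp add: mc mtrace_comm[of "mat_adjoint X" n n])
  moreover have "mtrace (E (mat_adjoint X * \<rho>) * Y) = mtrace (mat_adjoint X * \<rho> * X)"
    using dual c' by (simp add: is_dual_def)
  moreover have "mtrace (E (mat_adjoint X * \<rho> * X)) = mtrace (mat_adjoint X * \<rho> * X)"
    using c' by (simp add: cptp_mtrace)
  ultimately show ?thesis by (simp add: sandwich_trace_def)
qed

lemma petz_cptp:
  assumes \<alpha>: "0 < \<alpha>" "\<alpha> < 1" and \<rho>: "density n \<rho>" and \<sigma>: "density n \<sigma>"
  shows "petz \<alpha> \<rho> \<sigma> \<le> petz \<alpha> (E \<rho>) (E \<sigma>)"
proof -
  have "(\<Sum>j\<in>{()}. 1 * petz \<alpha> \<rho> \<sigma>) \<le> petz \<alpha> (E \<rho>) (E \<sigma>)"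
  proof (rule petz_comparison[OF \<alpha>])
    fix s :: real and Y :: "complex mat" assume s: "0 < s" and "Y \<in> carrier_mat m m"
    then obtain X where X: "is_dual Y X" using dual_exists by blast
    have "split_form n s \<rho> \<sigma> X \<le> split_form m s (E \<rho>) (E \<sigma>) Y"
      unfolding split_form_def
      using sandwich_trace_dual[OF _ X, of \<rho>] sandwich_trace_dual[OF _ dual_adjoint[OF dual_one_minus[OF X]], of \<sigma>] s \<rho> \<sigma>
      by (intro add_mono mult_left_mono) (auto simp: density_def)
    then show "\<exists>X\<in>carrier_mat n n. (\<Sum>j\<in>{()}. 1 * split_form n s \<rho> \<sigma> X) \<le> split_form m s (E \<rho>) (E \<sigma>) Y"
      using X by (auto simp: is_dual_def)
  qed (use \<rho> \<sigma> cptp_density in auto)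
  then show ?thesis by simp
qed

end

subsection \<open>Joint convexity\<close>

text \<open>For negative \<beta> both the power and the denominator reverse the order; there
  \<open>0 < q\<close> is essential because \<open>0 powr \<beta> = 0\<close>.\<close>

lemma power_entropy_antimono:
  fixes q q' \<alpha> \<beta> :: real
  assumes q: "0 < q" "q \<le> q'" and \<alpha>: "\<alpha> < 1" and \<beta>: "\<beta> \<noteq> 0"
  shows "(1 - q' powr \<beta>) / ((1 - \<alpha>) * \<beta>) \<le> (1 - q powr \<beta>) / ((1 - \<alpha>) * \<beta>)"
proof (cases "0 < \<beta>")
  case True
  then show ?thesis using q \<alpha> powr_mono2[of \<beta> q q'] by (intro divide_right_mono) auto
next
  case False
  then show ?thesis using q \<alpha> \<beta> powr_mono2'[of \<beta> q q']
    by (intro divide_right_mono_neg) (auto simp: mult_le_0_iff)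
qed

text \<open>The left side is concave in \<open>x\<close> with tangent \<open>x - 1\<close> at 1. For
  negative \<beta> this is the reversed Young inequality with exponent \<open>1 - \<beta>\<close>,
  for \<beta> between 0 and 1 the ordinary one.\<close>

lemma powr_tangent:
  fixes x \<beta> :: real
  assumes x: "0 < x" and \<beta>: "\<beta> \<noteq> 0" "\<beta> \<le> 1"
  shows "(x powr \<beta> - 1) / \<beta> \<le> x - 1"
proof -
  consider "\<beta> < 0" | "0 < \<beta>" "\<beta> < 1" | "\<beta> = 1" using \<beta> by linarith
  then show ?thesis
  proof cases
    case 1
    then show ?thesis using young_ge(1)[of "1 - \<beta>" 1 x] x by (simp add: field_simps)
  next
    case 2
    then show ?thesis using young_le(1)[of \<beta> x 1] x by (simp add: field_simps)
  qed (use x in simp)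
qed

text \<open>Jensen by way of the tangent at the mean: \<open>powr_tangent\<close> at
  \<open>q j / \<mu>\<close> bounds each deviation by a linear term, and the linear terms average to
  zero.\<close>

lemma power_entropy_jensen:
  fixes p q :: "'j \<Rightarrow> real" and \<alpha> \<beta> :: real
  assumes p: "\<And>j. j \<in> J \<Longrightarrow> 0 \<le> p j" "(\<Sum>j\<in>J. p j) = 1" and q: "\<And>j. j \<in> J \<Longrightarrow> 0 < q j"
    and \<mu>: "0 < (\<Sum>j\<in>J. p j * q j)" and \<alpha>: "\<alpha> < 1" and \<beta>: "\<beta> \<noteq> 0" "\<beta> \<le> 1"
  shows "(1 - (\<Sum>j\<in>J. p j * q j) powr \<beta>) / ((1 - \<alpha>) * \<beta>) \<le> (\<Sum>j\<in>J. p j * ((1 - q j powr \<beta>) / ((1 - \<alpha>) * \<beta>)))"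
proof -
  define \<mu> where "\<mu> = (\<Sum>j\<in>J. p j * q j)"
  have \<mu>0: "0 < \<mu>" using assms(4) by (simp add: \<mu>_def)
  have "(\<Sum>j\<in>J. p j * ((q j powr \<beta> - \<mu> powr \<beta>) / \<beta>)) \<le> (\<Sum>j\<in>J. p j * (\<mu> powr \<beta> * (q j / \<mu> - 1)))"
  proof (intro sum_mono mult_left_mono p)
    fix j assume j: "j \<in> J"
    have "(q j powr \<beta> - \<mu> powr \<beta>) / \<beta> = \<mu> powr \<beta> * (((q j / \<mu>) powr \<beta> - 1) / \<beta>)"
      using q[OF j] \<mu>0 by (simp add: powr_divide right_diff_distrib)
    also have "\<dots> \<le> \<mu> powr \<beta> * (q j / \<mu> - 1)"
      using q[OF j] \<mu>0 by (intro mult_left_mono powr_tangent \<beta>) auto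
    finally show "(q j powr \<beta> - \<mu> powr \<beta>) / \<beta> \<le> \<mu> powr \<beta> * (q j / \<mu> - 1)" .
  qed
  also have "\<dots> = \<mu> powr \<beta> * ((\<Sum>j\<in>J. p j * q j) / \<mu> - (\<Sum>j\<in>J. p j))"
    by (simp add: sum_distrib_left sum_subtractf[symmetric] sum_divide_distrib algebra_simps)
  also have "\<dots> = 0" using \<mu>0 p(2) by (simp add: \<mu>_def[symmetric])
  finally have le: "(\<Sum>j\<in>J. p j * ((q j powr \<beta> - \<mu> powr \<beta>) / \<beta>)) \<le> 0" .
  have split: "a * ((1 - x) / (\<gamma> * \<beta>)) = a * ((1 - y) / (\<gamma> * \<beta>)) - a * ((x - y) / \<beta>) / \<gamma>"
    if "\<gamma> \<noteq> 0" for a x y \<gamma> :: real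
    using that \<beta> by (simp add: field_simps)
  have "(\<Sum>j\<in>J. p j * ((1 - q j powr \<beta>) / ((1 - \<alpha>) * \<beta>)))
      = (\<Sum>j\<in>J. p j * ((1 - \<mu> powr \<beta>) / ((1 - \<alpha>) * \<beta>)) - p j * ((q j powr \<beta> - \<mu> powr \<beta>) / \<beta>) / (1 - \<alpha>))"
    using \<alpha> by (intro sum.cong refl split) simp
  also have "\<dots> = (\<Sum>j\<in>J. p j) * ((1 - \<mu> powr \<beta>) / ((1 - \<alpha>) * \<beta>)) - (\<Sum>j\<in>J. p j * ((q j powr \<beta> - \<mu> powr \<beta>) / \<beta>)) / (1 - \<alpha>)"
    by (simp only: sum_subtractf sum_distrib_right sum_divide_distrib)
  finally show ?thesis
    using le \<alpha> p(2) divide_nonpos_pos[OF le, of "1 - \<alpha>"] by (simp add: \<mu>_def)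
qed

lemma mtrace_mix_mult:
  assumes \<rho>: "\<And>j. j \<in> J \<Longrightarrow> \<rho> j \<in> carrier_mat n n" and B: "B \<in> carrier_mat n n"
  shows "mtrace (mix n J p \<rho> * B) = (\<Sum>j\<in>J. p j * mtrace (\<rho> j * B))"
proof -
  have "mtrace (mix n J p \<rho> * B) = (\<Sum>i<n. \<Sum>k<n. \<Sum>j\<in>J. p j * (\<rho> j $$ (i, k) * B $$ (k, i)))"
    unfolding mtrace_mult_eq[OF mix_carrier B] by (simp add: mix_def sum_distrib_right mult.assoc)
  also have "\<dots> = (\<Sum>i<n. \<Sum>j\<in>J. \<Sum>k<n. p j * (\<rho> j $$ (i, k) * B $$ (k, i)))"
    by (intro sum.cong refl sum.swap)
  also have "\<dots> = (\<Sum>j\<in>J. \<Sum>i<n. \<Sum>k<n. p j * (\<rho> j $$ (i, k) * B $$ (k, i)))" by (rule sum.swap)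
  also have "\<dots> = (\<Sum>j\<in>J. p j * mtrace (\<rho> j * B))"
    by (intro sum.cong refl) (simp add: mtrace_mult_eq[OF \<rho> B] sum_distrib_left)
  finally show ?thesis .
qed

lemma sandwich_trace_mix:
  assumes "\<And>j. j \<in> J \<Longrightarrow> \<rho> j \<in> carrier_mat n n" and "X \<in> carrier_mat n n"
  shows "sandwich_trace (mix n J p \<rho>) X = (\<Sum>j\<in>J. p j * sandwich_trace (\<rho> j) X)"
  unfolding sandwich_trace_def using assms by (subst mtrace_mix_mult) auto

text \<open>\<open>split_form\<close> is linear in the pair of states, so \<open>Y\<close> itself
  serves as the common trial matrix for all components.\<close>

lemma petz_concave:
  assumes \<alpha>: "0 < \<alpha>" "\<alpha> < 1" and J: "finite J" and p: "\<And>j. j \<in> J \<Longrightarrow> 0 \<le> p j" "(\<Sum>j\<in>J. p j) = 1"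
    and \<rho>: "\<And>j. j \<in> J \<Longrightarrow> density n (\<rho> j)" and \<sigma>: "\<And>j. j \<in> J \<Longrightarrow> density n (\<sigma> j)"
  shows "(\<Sum>j\<in>J. p j * petz \<alpha> (\<rho> j) (\<sigma> j)) \<le> petz \<alpha> (mix n J p \<rho>) (mix n J p \<sigma>)"
proof (rule petz_comparison[OF \<alpha> J p(1) \<rho> \<sigma> density_mix[OF p \<rho>] density_mix[OF p \<sigma>]])
  fix s :: real and Y :: "complex mat" assume Y: "Y \<in> carrier_mat n n"
  then have Y': "mat_adjoint (1\<^sub>m n - Y) \<in> carrier_mat n n" by auto
  have "split_form n s (mix n J p \<rho>) (mix n J p \<sigma>) Y = (\<Sum>j\<in>J. p j * split_form n s (\<rho> j) (\<sigma> j) Y)"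
    unfolding split_form_def
    using sandwich_trace_mix[of J \<rho> n Y p] sandwich_trace_mix[of J \<sigma> n "mat_adjoint (1\<^sub>m n - Y)" p] Y Y' \<rho> \<sigma>
    by (simp add: density_carrier distrib_left sum.distrib sum_distrib_left mult.left_commute)
  then show "\<exists>X\<in>carrier_mat n n. (\<Sum>j\<in>J. p j * split_form n s (\<rho> j) (\<sigma> j) X) \<le> split_form n s (mix n J p \<rho>) (mix n J p \<sigma>) Y"
    using Y by (intro bexI[of _ Y]) auto
qed

text \<open>Linearity of \<open>E\<close> maps the midpoint to the midpoint of the images, so each
  of the two summands follows from \<open>petz_cptp\<close>.\<close>

lemma J'_ab_cptp:
  assumes E: "cptp n m E" and \<rho>: "density n \<rho>" and \<sigma>: "density n \<sigma>" and \<alpha>: "0 < \<alpha>" "\<alpha> < 1" and \<beta>: "\<beta> \<noteq> 0"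
  shows "J'_ab \<alpha> \<beta> (E \<rho>) (E \<sigma>) \<le> J'_ab \<alpha> \<beta> \<rho> \<sigma>"
proof -
  note M = density_midpoint[OF \<rho> \<sigma>]
  note c = density_carrier[OF \<rho>] density_carrier[OF \<sigma>]
  have EM: "midpoint_mat (E \<rho>) (E \<sigma>) = E (midpoint_mat \<rho> \<sigma>)"
    using c by (simp add: cptp_add[OF E] cptp_smult[OF E] add_carrier_mat[of _ n n])
  have "D_ab \<alpha> \<beta> (E \<rho>') (E (midpoint_mat \<rho> \<sigma>)) \<le> D_ab \<alpha> \<beta> \<rho>' (midpoint_mat \<rho> \<sigma>)"
    if "density n \<rho>'" "0 < petz \<alpha> \<rho>' (midpoint_mat \<rho> \<sigma>)" for \<rho>'
    unfolding D_ab_petz using that \<alpha> \<beta> petz_cptp[OF E \<alpha> that(1) M] by (intro power_entropy_antimono) auto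
  then show ?thesis
    unfolding J'_ab_def EM
    using petz_midpoint(1)[OF \<rho> \<sigma>, of \<alpha>] petz_midpoint(1)[OF \<sigma> \<rho>, of \<alpha>] midpoint_comm[OF \<rho> \<sigma>] \<alpha> \<rho> \<sigma>
    by (intro divide_right_mono add_mono) auto
qed

lemma D_ab_convex:
  assumes \<alpha>: "0 < \<alpha>" "\<alpha> < 1" and \<beta>: "\<beta> \<noteq> 0" "\<beta> \<le> 1"
    and J: "finite J" and p: "\<And>j. j \<in> J \<Longrightarrow> 0 \<le> p j" "(\<Sum>j\<in>J. p j) = 1"
    and \<rho>: "\<And>j. j \<in> J \<Longrightarrow> density n (\<rho> j)" and \<sigma>: "\<And>j. j \<in> J \<Longrightarrow> density n (\<sigma> j)"
    and pos: "\<And>j. j \<in> J \<Longrightarrow> 0 < petz \<alpha> (\<rho> j) (\<sigma> j)"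
  shows "D_ab \<alpha> \<beta> (mix n J p \<rho>) (mix n J p \<sigma>) \<le> (\<Sum>j\<in>J. p j * D_ab \<alpha> \<beta> (\<rho> j) (\<sigma> j))"
proof -
  let ?\<mu> = "\<Sum>j\<in>J. p j * petz \<alpha> (\<rho> j) (\<sigma> j)"
  \<comment> \<open>Some weight is nonzero, which makes the average trace strictly positive.\<close>
  obtain j where j: "j \<in> J" "p j \<noteq> 0" using p(2) by (metis sum.neutral zero_neq_one)
  have \<mu>: "0 < ?\<mu>"
  proof (rule sum_pos2[OF J j(1)])
    show "0 < p j * petz \<alpha> (\<rho> j) (\<sigma> j)" using p(1)[OF j(1)] j(2) pos[OF j(1)] by simp
    show "0 \<le> p i * petz \<alpha> (\<rho> i) (\<sigma> i)" if "i \<in> J" for i using p(1)[OF that] pos[OF that] by simp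
  qed
  have "D_ab \<alpha> \<beta> (mix n J p \<rho>) (mix n J p \<sigma>) \<le> (1 - ?\<mu> powr \<beta>) / ((1 - \<alpha>) * \<beta>)"
    unfolding D_ab_petz by (rule power_entropy_antimono[OF \<mu> petz_concave[OF \<alpha> J p \<rho> \<sigma>] \<alpha>(2) \<beta>(1)])
  also have "\<dots> \<le> (\<Sum>j\<in>J. p j * D_ab \<alpha> \<beta> (\<rho> j) (\<sigma> j))"
    unfolding D_ab_petz by (rule power_entropy_jensen[OF p pos \<mu> \<alpha>(2) \<beta>])
  finally show ?thesis .
qed

text \<open>The midpoint of two mixtures is the mixture of the midpoints, so joint convexity of
  \<open>D_ab\<close> applies to each summand.\<close>

lemma J'_ab_convex:
  assumes \<alpha>: "0 < \<alpha>" "\<alpha> < 1" and \<beta>: "\<beta> \<noteq> 0" "\<beta> \<le> 1"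
    and J: "finite J" and p: "\<And>j. j \<in> J \<Longrightarrow> 0 \<le> p j" "(\<Sum>j\<in>J. p j) = 1"
    and \<rho>: "\<And>j. j \<in> J \<Longrightarrow> density n (\<rho> j)" and \<sigma>: "\<And>j. j \<in> J \<Longrightarrow> density n (\<sigma> j)"
  shows "J'_ab \<alpha> \<beta> (mix n J p \<rho>) (mix n J p \<sigma>) \<le> (\<Sum>j\<in>J. p j * J'_ab \<alpha> \<beta> (\<rho> j) (\<sigma> j))"
proof -
  let ?M = "\<lambda>j. midpoint_mat (\<rho> j) (\<sigma> j)"
  have "midpoint_mat (mix n J p \<rho>) (mix n J p \<sigma>) = mix n J p ?M"
  proof (rule eq_matI)
    fix a b assume "a < dim_row (mix n J p ?M)" "b < dim_col (mix n J p ?M)"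
    then have ab: "a < n" "b < n" by (auto simp: mix_def)
    then have "?M j $$ (a, b) = (\<rho> j $$ (a, b) + \<sigma> j $$ (a, b)) / 2" if "j \<in> J" for j
      using density_carrier[OF \<rho>[OF that]] density_carrier[OF \<sigma>[OF that]] by simp
    then show "midpoint_mat (mix n J p \<rho>) (mix n J p \<sigma>) $$ (a, b) = mix n J p ?M $$ (a, b)"
      using ab by (simp add: mix_def sum.distrib sum_divide_distrib distrib_left add_divide_distrib)
  qed (auto simp: mix_def)
  moreover have "D_ab \<alpha> \<beta> (mix n J p \<rho>) (mix n J p ?M) \<le> (\<Sum>j\<in>J. p j * D_ab \<alpha> \<beta> (\<rho> j) (?M j))"
    using \<alpha> \<rho> \<sigma> by (intro D_ab_convex \<alpha> \<beta> J p density_midpoint petz_midpoint(1)) auto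
  moreover have "D_ab \<alpha> \<beta> (mix n J p \<sigma>) (mix n J p ?M) \<le> (\<Sum>j\<in>J. p j * D_ab \<alpha> \<beta> (\<sigma> j) (?M j))"
  proof (intro D_ab_convex \<alpha> \<beta> J p density_midpoint \<rho> \<sigma>)
    fix j assume "j \<in> J"
    then show "0 < petz \<alpha> (\<sigma> j) (?M j)"
      using petz_midpoint(1)[OF \<sigma> \<rho>, of j j \<alpha>] midpoint_comm[OF \<rho> \<sigma>, of j j] \<alpha> by simp
  qed
  ultimately have "J'_ab \<alpha> \<beta> (mix n J p \<rho>) (mix n J p \<sigma>)
      \<le> ((\<Sum>j\<in>J. p j * D_ab \<alpha> \<beta> (\<rho> j) (?M j)) + (\<Sum>j\<in>J. p j * D_ab \<alpha> \<beta> (\<sigma> j) (?M j))) / 2"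
    unfolding J'_ab_def by simp
  also have "\<dots> = (\<Sum>j\<in>J. p j * J'_ab \<alpha> \<beta> (\<rho> j) (\<sigma> j))"
    unfolding J'_ab_def sum.distrib[symmetric] sum_divide_distrib by (simp add: distrib_left)
  finally show ?thesis .
qed

theorem theorem2:
  shows
  "(\<forall>n \<rho> \<sigma> \<alpha> \<beta>. density n \<rho> \<and> density n \<sigma> \<and> 0 < \<alpha> \<and> \<alpha> \<noteq> 1 \<and> \<beta> \<noteq> 0 \<longrightarrow>
      J'_ab \<alpha> \<beta> \<rho> \<sigma> \<ge> 0 \<and> (J'_ab \<alpha> \<beta> \<rho> \<sigma> = 0 \<longleftrightarrow> \<rho> = \<sigma>))
 \<and> (\<forall>n m \<rho> \<sigma> \<tau> \<alpha> \<beta>. density n \<rho> \<and> density n \<sigma> \<and> density m \<tau> \<and>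
      0 < \<alpha> \<and> \<alpha> \<noteq> 1 \<and> \<beta> \<noteq> 0 \<longrightarrow>
      J'_ab \<alpha> \<beta> (kron \<rho> \<tau>) (kron \<sigma> \<tau>) = J'_ab \<alpha> \<beta> \<rho> \<sigma>)
 \<and> (\<forall>n m E \<rho> \<sigma> \<alpha> \<beta>. density n \<rho> \<and> density n \<sigma> \<and> cptp n m E \<and>
      0 < \<alpha> \<and> \<alpha> < 1 \<and> \<beta> \<noteq> 0 \<and> \<beta> \<le> 1 \<longrightarrow>
      J'_ab \<alpha> \<beta> (E \<rho>) (E \<sigma>) \<le> J'_ab \<alpha> \<beta> \<rho> \<sigma>)
 \<and> (\<forall>n U \<rho> \<sigma> \<alpha> \<beta>. density n \<rho> \<and> density n \<sigma> \<and> unitary_mat n U \<and>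
      0 < \<alpha> \<and> \<alpha> \<noteq> 1 \<and> \<beta> \<noteq> 0 \<longrightarrow>
      J'_ab \<alpha> \<beta> (U * \<rho> * mat_adjoint U) (U * \<sigma> * mat_adjoint U) = J'_ab \<alpha> \<beta> \<rho> \<sigma>)
 \<and> (\<forall>n (J :: nat set) p \<rho>s \<sigma>s \<alpha> \<beta>. finite J \<and> (\<forall>j\<in>J. p j \<ge> 0) \<and> (\<Sum>j\<in>J. p j) = 1 \<and>
      (\<forall>j\<in>J. density n (\<rho>s j) \<and> density n (\<sigma>s j)) \<and>
      0 < \<alpha> \<and> \<alpha> < 1 \<and> \<beta> \<noteq> 0 \<and> \<beta> \<le> 1 \<longrightarrow>
      J'_ab \<alpha> \<beta> (mix n J p \<rho>s) (mix n J p \<sigma>s) \<le> (\<Sum>j\<in>J. p j * J'_ab \<alpha> \<beta> (\<rho>s j) (\<sigma>s j)))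
 \<and> (\<forall>n \<rho> \<sigma> \<alpha> \<beta>. density n \<rho> \<and> density n \<sigma> \<and> 0 < \<alpha> \<and> \<alpha> \<noteq> 1 \<and> \<beta> \<noteq> 0 \<longrightarrow>
      J'_ab \<alpha> \<beta> \<rho> \<sigma> = J'_ab \<alpha> \<beta> \<sigma> \<rho>)"
proof (intro conjI allI impI; elim conjE)
  show "0 \<le> J'_ab \<alpha> \<beta> \<rho> \<sigma>" and "J'_ab \<alpha> \<beta> \<rho> \<sigma> = 0 \<longleftrightarrow> \<rho> = \<sigma>"
    if "density n \<rho>" "density n \<sigma>" "0 < \<alpha>" "\<alpha> \<noteq> 1" "\<beta> \<noteq> 0" for n \<rho> \<sigma> \<alpha> \<beta>
    using J'_ab_nonneg[OF that] by auto
qed (auto intro: J'_ab_kron J'_ab_cptp J'_ab_unitary J'_ab_sym J'_ab_convex)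

end
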